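(* Let $\Omega\subset\mathbb{R}^N$ ($N\ge 2$) be a bounded smooth domain, $0<s<1<p<\infty$, $0<\alpha<1$, and let $\omega\in L^r(\Omega)\setminus\{0\}$ with $\omega\ge 0$ and $r\ge r_\alpha$. Let $u_\alpha\in W_0^{s,p}(\Omega)$ be the unique weak solution of the singular problem $(-\Delta_p)^s u=\omega u^{-\alpha}$ in $\Omega$, $u>0$ in $\Omega$, $u=0$ on $\mathbb{R}^N\setminus\Omega$. Set $$\mathcal{M}_\alpha:=\Big\{v\in W_0^{s,p}(\Omega):\int_\Omega |v|^{1-\alpha}\omega\,dx=1\Big\},\qquad U_\alpha:=\theta_\alpha u_\alpha,\quad \theta_\alpha:=\Big(\int_\Omega |u_\alpha|^{1-\alpha}\omega\,dx\Big)^{-\frac{1}{1-\alpha}}$$ (so that $U_\alpha\in\mathcal{M}_\alpha$). Then $$[U_\alpha]_{s,p}^p=[u_\alpha]_{s,p}^{\,p\left(\frac{1-\alpha-p}{1-\alpha}\right)}=\min_{v\in\mathcal{M}_\alpha}[v]_{s,p}^p.$$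
   Context: Gagliardo semi-norm: $[u]_{s,p}:=\left(\iint_{\mathbb{R}^{2N}}\frac{|u(x)-u(y)|^p}{|x-y|^{N+sp}}\,dx\,dy\right)^{1/p}$. $W_0^{s,p}(\Omega)$ is the completion of $C_c^\infty(\Omega)$ with respect to $([u]_{s,p}^p+\|u\|_p^p)^{1/p}$; equivalently $W_0^{s,p}(\Omega)=\{u\in L^p(\mathbb{R}^N):[u]_{s,p}<\infty,\ u=0 \text{ in }\mathbb{R}^N\setminus\Omega\}$, normed by $[\cdot]_{s,p}$. Pairing: $\langle(-\Delta_p)^s u,v\rangle:=\iint_{\mathbb{R}^{2N}}\frac{|u(x)-u(y)|^{p-2}(u(x)-u(y))(v(x)-v(y))}{|x-y|^{N+sp}}\,dx\,dy$ for $u,v\in W_0^{s,p}(\Omega)$. Weak solution: $u\in W_0^{s,p}(\Omega)$ is a weak solution of the singular problem $(-\Delta_p)^s u=\omega u^{-\alpha}$ in $\Omega$, $u>0$ in $\Omega$, $u=0$ on $\mathbb{R}^N\setminus\Omega$, if (i) for each subdomain $\Omega'$ compactly contained in $\Omega$ there is a constant $C_{\Omega'}>0$ with $u\ge C_{\Omega'}$ a.e. in $\Omega'$; and (ii) $\langle(-\Delta_p)^s u,\varphi\rangle=\int_\Omega\frac{\omega\varphi}{u^\alpha}\,dx$ for all $\varphi\in C_c^\infty(\Omega)$. Exponents: $p_s^\star:=\frac{Np}{N-sp}$ if $N>sp$ and $p_s^\star:=\infty$ if $N\le sp$; $t':=t/(t-1)$ is the Hölder conjugate. For $0<\alpha<1$: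 $r_\alpha:=\left(\frac{p_s^\star}{1-\alpha}\right)'$ if $sp<N$, and $r_\alpha:=\alpha^{-1}$ if $sp\ge N$. Under the stated assumptions on $\omega$ and $r$, the weak solution $u_\alpha$ exists and is unique. *)

theory Defs
  imports "HOL-Analysis.Analysis"
begin

primrec C_k :: "nat \<Rightarrow> ('a::euclidean_space \<Rightarrow> real) \<Rightarrow> bool" where
  "C_k 0 f \<longleftrightarrow> continuous_on UNIV f"
| "C_k (Suc k) f \<longleftrightarrow>
     f differentiable_on UNIV \<and> (\<forall>v. C_k k (\<lambda>x. frechet_derivative f (at x) v))"

definition smooth :: "('a::euclidean_space \<Rightarrow> real) \<Rightarrow> bool" where
  "smooth f \<longleftrightarrow> (\<forall>k. C_k k f)"

definition test_functions :: "'a::euclidean_space set \<Rightarrow> ('a \<Rightarrow> real) set" where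
  "test_functions \<Omega> =
     {\<phi>. smooth \<phi> \<and> compact (closure {x. \<phi> x \<noteq> 0}) \<and> closure {x. \<phi> x \<noteq> 0} \<subseteq> \<Omega>}"

definition is_domain :: "'a::euclidean_space set \<Rightarrow> bool" where
  "is_domain \<Omega> \<longleftrightarrow> open \<Omega> \<and> connected \<Omega> \<and> \<Omega> \<noteq> {}"

text \<open>Near each boundary point, the set is the strict epigraph of a smooth function over the
  hyperplane orthogonal to some unit vector \<open>e\<close>, i.e. the usual condition
  \<open>x\<^sub>N > \<gamma> (x\<^sub>1, \<dots>, x\<^sub>N\<^sub>-\<^sub>1)\<close> in rotated coordinates. The function \<open>\<gamma>\<close> lives on the
  whole space but is only evaluated on the hyperplane; any smooth function on the
  hyperplane extends via the orthogonal projection.\<close>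

definition smooth_boundary :: "'a::euclidean_space set \<Rightarrow> bool" where
  "smooth_boundary \<Omega> \<longleftrightarrow>
     (\<forall>z\<in>frontier \<Omega>. \<exists>\<rho>>0. \<exists>e \<gamma>. norm e = 1 \<and> smooth \<gamma> \<and>
        \<Omega> \<inter> ball z \<rho> = {x \<in> ball z \<rho>. \<gamma> (x - (x \<bullet> e) *\<^sub>R e) < x \<bullet> e})"

definition bounded_smooth_domain :: "'a::euclidean_space set \<Rightarrow> bool" where
  "bounded_smooth_domain \<Omega> \<longleftrightarrow> is_domain \<Omega> \<and> bounded \<Omega> \<and> smooth_boundary \<Omega>"

text \<open>Members of function spaces are represented by measurable functions, without passing to
  classes modulo almost everywhere equality.\<close>

definition Lp :: "ereal \<Rightarrow> 'b measure \<Rightarrow> ('b \<Rightarrow> real) set" where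
  "Lp r M = {f \<in> borel_measurable M.
     if r = \<infinity> then \<exists>C. AE x in M. \<bar>f x\<bar> \<le> C
     else integrable M (\<lambda>x. \<bar>f x\<bar> powr real_of_ereal r)}"

text \<open>The double integral defining the seminorm, with values in \<open>[0, \<infinity>]\<close> so that finiteness
  is expressible; the seminorm itself is meaningful only when it is finite. On the diagonal,
  division by zero yields the value 0.\<close>

definition gagliardo_energy :: "real \<Rightarrow> real \<Rightarrow> ('a::euclidean_space \<Rightarrow> real) \<Rightarrow> ennreal" where
  "gagliardo_energy s p u =
     (\<integral>\<^sup>+(x, y). ennreal (\<bar>u x - u y\<bar> powr p / norm (x - y) powr (real DIM('a) + s * p))
        \<partial>(lebesgue \<Otimes>\<^sub>M lebesgue))"

definition gagliardo :: "real \<Rightarrow> real \<Rightarrow> ('a::euclidean_space \<Rightarrow> real) \<Rightarrow> real" where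
  "gagliardo s p u = enn2real (gagliardo_energy s p u) powr (1 / p)"

definition Wsp :: "real \<Rightarrow> real \<Rightarrow> ('a::euclidean_space \<Rightarrow> real) set" where
  "Wsp s p = {u \<in> Lp (ereal p) lebesgue. gagliardo_energy s p u < \<infinity>}"

text \<open>The completion of the test functions with respect to
  \<open>([u]\<^sup>p + \<parallel>u\<parallel>\<^sup>p)\<^bsup>1/p\<^esup>\<close>, realised as their closure in the (complete) space \<open>Wsp s p\<close>.
  Its members vanish almost everywhere outside \<open>\<Omega>\<close>.\<close>

definition Wsp0 :: "real \<Rightarrow> real \<Rightarrow> 'a::euclidean_space set \<Rightarrow> ('a \<Rightarrow> real) set" where
  "Wsp0 s p \<Omega> = {u \<in> Wsp s p. \<exists>\<phi>. (\<forall>n. \<phi> n \<in> test_functions \<Omega>) \<and>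
     (\<lambda>n. gagliardo_energy s p (\<lambda>x. \<phi> n x - u x)
           + (\<integral>\<^sup>+x. ennreal (\<bar>\<phi> n x - u x\<bar> powr p) \<partial>lebesgue)) \<longlonglongrightarrow> 0}"

definition frac_p_laplace_pairing ::
    "real \<Rightarrow> real \<Rightarrow> ('a::euclidean_space \<Rightarrow> real) \<Rightarrow> ('a \<Rightarrow> real) \<Rightarrow> real" where
  "frac_p_laplace_pairing s p u v =
     (\<integral>(x, y). \<bar>u x - u y\<bar> powr (p - 2) * (u x - u y) * (v x - v y)
                / norm (x - y) powr (real DIM('a) + s * p) \<partial>(lebesgue \<Otimes>\<^sub>M lebesgue))"

text \<open>No integrability clause is needed in the equation: for \<open>u\<close> and \<open>\<phi>\<close> in \<open>Wsp0 s p \<Omega>\<close> and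
  \<open>p > 1\<close> the left integrand is integrable by Hoelder. If \<open>\<omega>\<close> is integrable on \<open>\<Omega>\<close>, so is the
  right one, since \<open>u\<close> is bounded below on the support of \<open>\<phi>\<close>.\<close>

definition weak_solution ::
    "real \<Rightarrow> real \<Rightarrow> real \<Rightarrow> 'a::euclidean_space set \<Rightarrow> ('a \<Rightarrow> real) \<Rightarrow> ('a \<Rightarrow> real) \<Rightarrow> bool" where
  "weak_solution s p \<alpha> \<Omega> \<omega> u \<longleftrightarrow>
     u \<in> Wsp0 s p \<Omega> \<and>
     (\<forall>\<Omega>'. is_domain \<Omega>' \<and> compact (closure \<Omega>') \<and> closure \<Omega>' \<subseteq> \<Omega> \<longrightarrow>
        (\<exists>C>0. AE x in lebesgue. x \<in> \<Omega>' \<longrightarrow> C \<le> u x)) \<and>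
     (\<forall>\<phi>\<in>test_functions \<Omega>.
        frac_p_laplace_pairing s p u \<phi> = (LINT x:\<Omega>|lebesgue. \<omega> x * \<phi> x / u x powr \<alpha>))"

definition hoelder_conj :: "real \<Rightarrow> real" where
  "hoelder_conj t = t / (t - 1)"

definition critical_exponent :: "real \<Rightarrow> real \<Rightarrow> real \<Rightarrow> ereal" where
  "critical_exponent N s p = (if s * p < N then ereal (N * p / (N - s * p)) else \<infinity>)"

definition r_exponent :: "real \<Rightarrow> real \<Rightarrow> real \<Rightarrow> real \<Rightarrow> real" where
  "r_exponent N s p \<alpha> =
     (if s * p < N then hoelder_conj (real_of_ereal (critical_exponent N s p) / (1 - \<alpha>))
      else 1 / \<alpha>)"

definition constraint_set ::
    "real \<Rightarrow> real \<Rightarrow> real \<Rightarrow> 'a::euclidean_space set \<Rightarrow> ('a \<Rightarrow> real) \<Rightarrow> ('a \<Rightarrow> real) set" where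
  "constraint_set s p \<alpha> \<Omega> \<omega> =
     {v \<in> Wsp0 s p \<Omega>. (LINT x:\<Omega>|lebesgue. \<bar>v x\<bar> powr (1 - \<alpha>) * \<omega> x) = 1}"

definition theta ::
    "real \<Rightarrow> 'a::euclidean_space set \<Rightarrow> ('a \<Rightarrow> real) \<Rightarrow> ('a \<Rightarrow> real) \<Rightarrow> real" where
  "theta \<alpha> \<Omega> \<omega> u = (LINT x:\<Omega>|lebesgue. \<bar>u x\<bar> powr (1 - \<alpha>) * \<omega> x) powr (- 1 / (1 - \<alpha>))"

end

theory Submission imports Defs begin

text \<open>Write \<open>E = [u]\<^sup>p\<close>. Extend the equation from test functions \<open>\<phi>\<close> to all of \<open>W\<^sub>0\<close>: testing with
  the smooth functions \<open>sqrt (\<phi>\<^sup>2 + \<epsilon>\<^sup>2) - \<epsilon>\<close>, which increase to \<open>\<bar>\<phi>\<bar>\<close> and whose increments are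
  dominated by those of \<open>\<phi>\<close>, and then applying Fatou's lemma and Hoelder's inequality gives
  \<open>\<integral> \<omega> \<bar>v\<bar> u\<^bsup>-\<alpha>\<^esup> \<le> E\<^bsup>(p-1)/p\<^esup> [v]\<close> for every \<open>v\<close> in \<open>W\<^sub>0\<close>. Applied to \<open>v = \<phi>\<^sub>n - u\<close> with \<open>\<phi>\<^sub>n \<rightarrow> u\<close>, this makes
  \<open>u\<close> itself admissible in the equation, so \<open>\<integral> \<omega> u\<^bsup>1-\<alpha>\<^esup> = E\<close>; no Sobolev embedding is needed.
  Hoelder's inequality with exponents \<open>1 - \<alpha>\<close> and \<open>\<alpha>\<close> now yields
  \<open>\<integral> \<omega> \<bar>v\<bar>\<^bsup>1-\<alpha>\<^esup> \<le> (\<integral> \<omega> \<bar>v\<bar> u\<^bsup>-\<alpha>\<^esup>)\<^bsup>1-\<alpha>\<^esup> (\<integral> \<omega> u\<^bsup>1-\<alpha>\<^esup>)\<^bsup>\<alpha>\<^esup> \<le> E\<^bsup>(p-1+\<alpha>)/p\<^esup> [v]\<^bsup>1-\<alpha>\<^esup>\<close>,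
  a lower bound for \<open>[v]\<close> on the constraint set which the rescaled solution attains.\<close>

section \<open>Test functions\<close>

lemma C_k_Suc_imp: "C_k (Suc k) f \<Longrightarrow> C_k k f"
proof (induction k arbitrary: f)
  case 0
  then show ?case by (simp add: differentiable_imp_continuous_on)
next
  case (Suc k)
  then show ?case unfolding C_k.simps(2)[of "Suc k" f] C_k.simps(2)[of k f] by blast
qed

text \<open>The recursion in \<open>C_k\<close> refers to the chosen derivative
  \<open>frechet_derivative\<close>. Since derivatives at a point are unique, any explicit formula
  for the derivative may be used in its place.\<close>

lemma C_k_SucI:
  assumes "\<And>x. (f has_derivative f' x) (at x)" and "\<And>v. C_k k (\<lambda>x. f' x v)"
  shows "C_k (Suc k) f"
proof -
  have "frechet_derivative f (at x) = f' x" for x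
    using frechet_derivative_at[OF assms(1)] by simp
  moreover have "f differentiable_on UNIV"
    using assms(1) by (auto simp: differentiable_on_def differentiable_def)
  ultimately show ?thesis using assms(2) by simp
qed

lemma C_k_SucD:
  assumes "C_k (Suc k) f"
  shows "(f has_derivative frechet_derivative f (at x)) (at x)"
    and "C_k k (\<lambda>x. frechet_derivative f (at x) v)"
  using assms by (auto simp: differentiable_on_def frechet_derivative_works[symmetric])

lemma C_k_const: "C_k k (\<lambda>x. c)"
proof (induction k arbitrary: c)
  case (Suc k)
  show ?case by (rule C_k_SucI[where f' = "\<lambda>x v. 0"]) (auto intro: Suc)
qed simp

lemma C_k_add: "C_k k f \<Longrightarrow> C_k k g \<Longrightarrow> C_k k (\<lambda>x. f x + g x)"
proof (induction k arbitrary: f g)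
  case 0
  then show ?case by (simp add: continuous_on_add)
next
  case (Suc k)
  show ?case
    by (rule C_k_SucI[OF has_derivative_add[OF C_k_SucD(1)[OF Suc.prems(1)] C_k_SucD(1)[OF Suc.prems(2)]]])
       (intro Suc.IH C_k_SucD(2) Suc.prems)
qed

lemma C_k_mult: "C_k k f \<Longrightarrow> C_k k g \<Longrightarrow> C_k k (\<lambda>x. f x * g x)"
proof (induction k arbitrary: f g)
  case 0
  then show ?case by (simp add: continuous_on_mult)
next
  case (Suc k)
  show ?case
    by (rule C_k_SucI[OF has_derivative_mult[OF C_k_SucD(1)[OF Suc.prems(1)] C_k_SucD(1)[OF Suc.prems(2)]]])
       \<comment> \<open>The product rule leaves one factor undifferentiated in each summand, so
         \<open>f\<close> and \<open>g\<close> themselves are needed at order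
         \<open>k\<close>.\<close>
       (intro C_k_add Suc.IH C_k_SucD(2) Suc.prems C_k_Suc_imp[OF Suc.prems(1)] C_k_Suc_imp[OF Suc.prems(2)])
qed

text \<open>Differentiation lowers the exponent by one, so the induction has to run over all
  \<open>a\<close> at once. Positivity of \<open>f\<close> keeps the power differentiable for every
  real exponent.\<close>

lemma C_k_powr:
  assumes "C_k k f" "\<And>x. 0 < f x"
  shows "C_k k (\<lambda>x. f x powr a)"
  using assms
proof (induction k arbitrary: a)
  case 0
  then show ?case by (auto intro!: continuous_on_powr' simp: less_le)
next
  case (Suc k)
  have "((\<lambda>x. f x powr a) has_derivative
      (\<lambda>v. a * f x powr (a - 1) * frechet_derivative f (at x) v)) (at x)" for x
    using Suc.prems(2)[of x]
    by (auto intro!: derivative_eq_intros C_k_SucD(1)[OF Suc.prems(1)]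
        simp: fun_eq_iff powr_diff field_simps)
  then show ?case
    by (rule C_k_SucI)
      (intro C_k_mult C_k_const Suc.IH Suc.prems(2) C_k_Suc_imp[OF Suc.prems(1)] C_k_SucD(2)[OF Suc.prems(1)])
qed

text \<open>Adding the square of \<open>\<epsilon>\<close> keeps the radicand positive, hence away
  from the point where the square root fails to be differentiable.\<close>

lemma smooth_sqrt_regularisation:
  assumes "smooth \<phi>" "0 < \<epsilon>"
  shows "smooth (\<lambda>x. sqrt ((\<phi> x)\<^sup>2 + \<epsilon>\<^sup>2) - \<epsilon>)"
  unfolding smooth_def
proof
  fix k
  have pos: "0 < \<phi> x * \<phi> x + \<epsilon> * \<epsilon>" for x
    using assms(2) by (simp add: add_nonneg_pos)
  have "C_k k (\<lambda>x. (\<phi> x * \<phi> x + \<epsilon> * \<epsilon>) powr (1/2) + (- \<epsilon>))"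
    using assms(1) pos unfolding smooth_def
    by (intro C_k_add C_k_powr C_k_mult C_k_const) auto
  then show "C_k k (\<lambda>x. sqrt ((\<phi> x)\<^sup>2 + \<epsilon>\<^sup>2) - \<epsilon>)"
    using pos by (simp add: powr_half_sqrt less_imp_le power2_eq_square)
qed

section \<open>Closure properties of the test functions\<close>

lemma test_functionsI:
  assumes "smooth \<psi>" "\<phi> \<in> test_functions \<Omega>" "\<phi>' \<in> test_functions \<Omega>"
    and "\<And>x. \<phi> x = 0 \<Longrightarrow> \<phi>' x = 0 \<Longrightarrow> \<psi> x = 0"
  shows "\<psi> \<in> test_functions \<Omega>"
proof -
  let ?S = "\<lambda>f. closure {x. f x \<noteq> 0}"
  have "{x. \<psi> x \<noteq> 0} \<subseteq> {x. \<phi> x \<noteq> 0} \<union> {x. \<phi>' x \<noteq> 0}"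
    using assms(4) by auto
  then have sub: "?S \<psi> \<subseteq> ?S \<phi> \<union> ?S \<phi>'"
    by (metis closure_Un closure_mono)
  have un: "compact (?S \<phi> \<union> ?S \<phi>')" "?S \<phi> \<union> ?S \<phi>' \<subseteq> \<Omega>"
    using assms(2,3) by (auto simp: test_functions_def)
  have "compact (?S \<psi>)"
    using compact_Int_closed[OF un(1), of "?S \<psi>"] sub by (simp add: Int_absorb1)
  then show ?thesis
    using sub un(2) assms(1) by (auto simp: test_functions_def)
qed

lemma test_functions_cmult:
  assumes "\<phi> \<in> test_functions \<Omega>"
  shows "(\<lambda>x. c * \<phi> x) \<in> test_functions \<Omega>"
proof (rule test_functionsI[OF _ assms assms])
  show "smooth (\<lambda>x. c * \<phi> x)"
    using assms by (auto simp: test_functions_def smooth_def intro!: C_k_mult C_k_const)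
qed simp

lemma test_functions_diff:
  assumes "\<phi> \<in> test_functions \<Omega>" "\<psi> \<in> test_functions \<Omega>"
  shows "(\<lambda>x. \<phi> x - \<psi> x) \<in> test_functions \<Omega>"
proof (rule test_functionsI[OF _ assms])
  have "C_k k (\<lambda>x. \<phi> x + (-1) * \<psi> x)" for k
    using assms unfolding test_functions_def smooth_def
    by (intro C_k_add C_k_mult C_k_const) auto
  then show "smooth (\<lambda>x. \<phi> x - \<psi> x)"
    by (simp add: smooth_def)
qed simp

text \<open>Subtracting \<open>\<epsilon>\<close> makes the regularisation vanish wherever
  \<open>\<phi>\<close> does, so the support does not grow.\<close>

lemma test_functions_sqrt_regularisation:
  assumes "\<phi> \<in> test_functions \<Omega>" "0 < \<epsilon>"
  shows "(\<lambda>x. sqrt ((\<phi> x)\<^sup>2 + \<epsilon>\<^sup>2) - \<epsilon>) \<in> test_functions \<Omega>"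
  using assms by (intro test_functionsI[OF smooth_sqrt_regularisation _ assms(1)])
    (auto simp: test_functions_def)

lemma test_functions_continuous: "\<phi> \<in> test_functions \<Omega> \<Longrightarrow> continuous_on UNIV \<phi>"
  by (auto simp: test_functions_def smooth_def dest: spec[of _ 0])

lemma test_functions_measurable: "\<phi> \<in> test_functions \<Omega> \<Longrightarrow> \<phi> \<in> borel_measurable lebesgue"
  by (intro measurable_completion)
    (simp add: borel_measurable_continuous_onI test_functions_continuous)

text \<open>This is the reverse triangle inequality for the plane vectors
  \<open>(a, \<epsilon>)\<close> and \<open>(b, \<epsilon>)\<close>.\<close>

lemma sqrt_regularisation_lipschitz:
  "\<bar>(sqrt (a\<^sup>2 + \<epsilon>\<^sup>2) - \<epsilon>) - (sqrt (b\<^sup>2 + \<epsilon>\<^sup>2) - \<epsilon>)\<bar> \<le> \<bar>a - b\<bar>"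
  using norm_triangle_ineq3[of "(a, \<epsilon>)" "(b, \<epsilon>)"] by (simp add: norm_prod_def)

section \<open>Hoelder's inequality\<close>

lemma Young_powr:
  fixes a b t :: real
  assumes "0 \<le> a" "0 \<le> b" "0 < t" "t < 1"
  shows "a powr t * b powr (1 - t) \<le> t * a + (1 - t) * b"
proof (cases "a = 0 \<or> b = 0")
  case False
  then have ab: "0 < a" "0 < b" using assms by auto
  show ?thesis using Youngs_inequality_0[of t "1 - t" a b] ab assms by simp
qed (use assms in auto)

text \<open>Young's inequality for \<open>f x / A\<close> and \<open>g x / B\<close>, with
  \<open>A\<close> and \<open>B\<close> the two integrals, integrates to the total weight
  \<open>t + (1 - t) = 1\<close>. If \<open>A\<close> or \<open>B\<close> is zero, then
  \<open>f\<close> or \<open>g\<close> vanishes almost everywhere. The form with exponents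
  \<open>t\<close> and \<open>1 - t\<close> serves both the energy, with
  \<open>t = 1 - 1 / p\<close>, and the constraint integral, with
  \<open>t = 1 - \<alpha>\<close>.\<close>

lemma Hoelder_powr:
  fixes f g :: "'b \<Rightarrow> real"
  assumes "integrable M f" "integrable M g" "0 < t" "t < 1"
    and "AE x in M. 0 \<le> f x" "AE x in M. 0 \<le> g x"
  shows "integrable M (\<lambda>x. f x powr t * g x powr (1 - t))"
    and "(\<integral>x. f x powr t * g x powr (1 - t) \<partial>M) \<le> (\<integral>x. f x \<partial>M) powr t * (\<integral>x. g x \<partial>M) powr (1 - t)"
proof -
  note [measurable] = borel_measurable_integrable[OF assms(1)] borel_measurable_integrable[OF assms(2)]
  show int: "integrable M (\<lambda>x. f x powr t * g x powr (1 - t))"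
  proof (rule Bochner_Integration.integrable_bound)
    show "integrable M (\<lambda>x. t * f x + (1 - t) * g x)" using assms by auto
    show "AE x in M. norm (f x powr t * g x powr (1 - t)) \<le> norm (t * f x + (1 - t) * g x)"
      using assms(5,6)
    proof eventually_elim
      case (elim x)
      then show ?case using Young_powr[of "f x" "g x" t] assms by simp
    qed
  qed simp
  define A where "A = (\<integral>x. f x \<partial>M)"
  define B where "B = (\<integral>x. g x \<partial>M)"
  have AB: "0 \<le> A" "0 \<le> B" unfolding A_def B_def using assms by (auto intro: integral_nonneg_AE)
  show "(\<integral>x. f x powr t * g x powr (1 - t) \<partial>M) \<le> (\<integral>x. f x \<partial>M) powr t * (\<integral>x. g x \<partial>M) powr (1 - t)"
  proof (cases "A = 0 \<or> B = 0")
    case True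
    then have "(AE x in M. f x = 0) \<or> (AE x in M. g x = 0)"
      using integral_nonneg_eq_0_iff_AE[OF assms(1,5)] integral_nonneg_eq_0_iff_AE[OF assms(2,6)]
      by (auto simp: A_def B_def)
    then have "AE x in M. f x powr t * g x powr (1 - t) = 0"
      by (auto elim!: eventually_mono)
    then have "(\<integral>x. f x powr t * g x powr (1 - t) \<partial>M) = 0"
      by (simp add: integral_eq_zero_AE)
    then show ?thesis by simp
  next
    case False
    then have pos: "0 < A" "0 < B" using AB by auto
    define K where "K = A powr t * B powr (1 - t)"
    have K: "0 < K" using pos by (simp add: K_def)
    have "(\<integral>x. f x powr t * g x powr (1 - t) \<partial>M) \<le> (\<integral>x. K * (t * (f x / A) + (1 - t) * (g x / B)) \<partial>M)"
    proof (rule integral_mono_AE[OF int])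
      show "integrable M (\<lambda>x. K * (t * (f x / A) + (1 - t) * (g x / B)))"
        using assms by auto
      show "AE x in M. f x powr t * g x powr (1 - t) \<le> K * (t * (f x / A) + (1 - t) * (g x / B))"
        using assms(5,6)
      proof eventually_elim
        case (elim x)
        have "f x powr t * g x powr (1 - t) = K * ((f x / A) powr t * (g x / B) powr (1 - t))"
          using elim pos by (simp add: K_def powr_divide)
        then show ?case
          using Young_powr[of "f x / A" "g x / B" t] elim pos assms K by (simp add: mult_left_mono)
      qed
    qed
    also have "\<dots> = K"
      using assms pos by (simp add: A_def[symmetric] B_def[symmetric])
    finally show ?thesis by (simp add: K_def A_def B_def)
  qed
qed

section \<open>The Gagliardo energy and the pairing\<close>

definition gagliardo_density ::
    "real \<Rightarrow> real \<Rightarrow> ('a::euclidean_space \<Rightarrow> real) \<Rightarrow> 'a \<times> 'a \<Rightarrow> real" where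
  "gagliardo_density s p u z =
     \<bar>u (fst z) - u (snd z)\<bar> powr p / norm (fst z - snd z) powr (real DIM('a) + s * p)"

text \<open>This is the absolute value of the integrand of the pairing. Unlike the signed integrand
  it is monotone in the increments of \<open>v\<close>, which is what the comparison arguments
  use.\<close>

definition pairing_density ::
    "real \<Rightarrow> real \<Rightarrow> ('a::euclidean_space \<Rightarrow> real) \<Rightarrow> ('a \<Rightarrow> real) \<Rightarrow> 'a \<times> 'a \<Rightarrow> real" where
  "pairing_density s p u v z =
     \<bar>u (fst z) - u (snd z)\<bar> powr (p - 1) * \<bar>v (fst z) - v (snd z)\<bar>
       / norm (fst z - snd z) powr (real DIM('a) + s * p)"

definition signed_pairing_density ::
    "real \<Rightarrow> real \<Rightarrow> ('a::euclidean_space \<Rightarrow> real) \<Rightarrow> ('a \<Rightarrow> real) \<Rightarrow> 'a \<times> 'a \<Rightarrow> real" where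
  "signed_pairing_density s p u v z =
     \<bar>u (fst z) - u (snd z)\<bar> powr (p - 2) * (u (fst z) - u (snd z)) * (v (fst z) - v (snd z))
       / norm (fst z - snd z) powr (real DIM('a) + s * p)"

definition gagliardo_finite :: "real \<Rightarrow> real \<Rightarrow> ('a::euclidean_space \<Rightarrow> real) \<Rightarrow> bool" where
  "gagliardo_finite s p u \<longleftrightarrow> u \<in> borel_measurable lebesgue \<and>
     integrable (lebesgue \<Otimes>\<^sub>M lebesgue) (gagliardo_density s p u)"

text \<open>The p-th power of the seminorm as a real number. It carries this meaning only together
  with \<open>gagliardo_finite\<close>, because the integral defaults to 0 otherwise.\<close>

definition gagliardo_integral :: "real \<Rightarrow> real \<Rightarrow> ('a::euclidean_space \<Rightarrow> real) \<Rightarrow> real" where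
  "gagliardo_integral s p u = (\<integral>z. gagliardo_density s p u z \<partial>(lebesgue \<Otimes>\<^sub>M lebesgue))"

definition pairing_bound ::
    "real \<Rightarrow> real \<Rightarrow> ('a::euclidean_space \<Rightarrow> real) \<Rightarrow> ('a \<Rightarrow> real) \<Rightarrow> real" where
  "pairing_bound s p u v = (\<integral>z. pairing_density s p u v z \<partial>(lebesgue \<Otimes>\<^sub>M lebesgue))"

section \<open>Measurability on the product of two Lebesgue measures\<close>

lemma measurable_kernel:
  "(\<lambda>z::'a::euclidean_space \<times> 'a. norm (fst z - snd z) powr \<kappa>)
     \<in> borel_measurable (lebesgue \<Otimes>\<^sub>M lebesgue)"
proof -
  have id: "(\<lambda>x::'a. x) \<in> borel_measurable lebesgue"
    by (intro measurable_completion) simp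
  note [measurable] = measurable_compose[OF measurable_fst id] measurable_compose[OF measurable_snd id]
  show ?thesis by measurable
qed

lemma measurable_increment:
  assumes "u \<in> borel_measurable lebesgue"
  shows "(\<lambda>z::'a::euclidean_space \<times> 'a. u (fst z) - u (snd z) :: real)
     \<in> borel_measurable (lebesgue \<Otimes>\<^sub>M lebesgue)"
proof -
  note [measurable] = measurable_compose[OF measurable_fst assms] measurable_compose[OF measurable_snd assms]
  show ?thesis by measurable
qed

lemma measurable_gagliardo_density:
  assumes "u \<in> borel_measurable lebesgue"
  shows "gagliardo_density s p u \<in> borel_measurable (lebesgue \<Otimes>\<^sub>M lebesgue)"
proof -
  note [measurable] = measurable_increment[OF assms] measurable_kernel
  show ?thesis unfolding gagliardo_density_def[abs_def] by measurable
qed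

lemma measurable_signed_pairing_density:
  assumes "u \<in> borel_measurable lebesgue" "v \<in> borel_measurable lebesgue"
  shows "signed_pairing_density s p u v \<in> borel_measurable (lebesgue \<Otimes>\<^sub>M lebesgue)"
proof -
  note [measurable] = measurable_increment[OF assms(1)] measurable_increment[OF assms(2)] measurable_kernel
  show ?thesis unfolding signed_pairing_density_def[abs_def] by measurable
qed

lemma gagliardo_density_nonneg: "0 \<le> gagliardo_density s p u z"
  by (simp add: gagliardo_density_def)

lemma pairing_density_nonneg: "0 \<le> pairing_density s p u v z"
  by (simp add: pairing_density_def)

lemma gagliardo_integral_nonneg: "0 \<le> gagliardo_integral s p u"
  by (simp add: gagliardo_integral_def gagliardo_density_nonneg)

section \<open>Functions of finite energy\<close>

lemma gagliardo_energy_density: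
  "gagliardo_energy s p u = (\<integral>\<^sup>+z. ennreal (gagliardo_density s p u z) \<partial>(lebesgue \<Otimes>\<^sub>M lebesgue))"
  by (simp add: gagliardo_energy_def gagliardo_density_def case_prod_beta')

lemma frac_p_laplace_pairing_density:
  "frac_p_laplace_pairing s p u v = (\<integral>z. signed_pairing_density s p u v z \<partial>(lebesgue \<Otimes>\<^sub>M lebesgue))"
  by (simp add: frac_p_laplace_pairing_def signed_pairing_density_def case_prod_beta')

lemma gagliardo_finiteI:
  assumes "u \<in> borel_measurable lebesgue" "gagliardo_energy s p u < \<infinity>"
  shows "gagliardo_finite s p u"
  unfolding gagliardo_finite_def
  using assms measurable_gagliardo_density[OF assms(1), of s p]
  by (auto intro!: integrableI_nonneg simp: gagliardo_density_nonneg gagliardo_energy_density)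

lemma gagliardo_energy_finite:
  assumes "gagliardo_finite s p u"
  shows "gagliardo_energy s p u = ennreal (gagliardo_integral s p u)"
  using assms unfolding gagliardo_finite_def gagliardo_energy_density gagliardo_integral_def
  by (intro nn_integral_eq_integral) (auto simp: gagliardo_density_nonneg)

lemma gagliardo_eq_powr:
  assumes "gagliardo_finite s p u"
  shows "gagliardo s p u = gagliardo_integral s p u powr (1 / p)"
  by (simp add: gagliardo_def gagliardo_energy_finite[OF assms] gagliardo_integral_nonneg)

text \<open>This transfers finite energy from a test function to its regularisations, whose
  increments it dominates.\<close>

lemma gagliardo_finite_lipschitz:
  assumes "gagliardo_finite s p v" "w \<in> borel_measurable lebesgue" "0 < p"
    and "\<And>x y. \<bar>w x - w y\<bar> \<le> \<bar>v x - v y\<bar>"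
  shows "gagliardo_finite s p w"
proof -
  have "integrable (lebesgue \<Otimes>\<^sub>M lebesgue) (gagliardo_density s p w)"
  proof (rule Bochner_Integration.integrable_bound)
    show "integrable (lebesgue \<Otimes>\<^sub>M lebesgue) (gagliardo_density s p v)"
      using assms(1) by (simp add: gagliardo_finite_def)
    show "AE z in lebesgue \<Otimes>\<^sub>M lebesgue. norm (gagliardo_density s p w z) \<le> norm (gagliardo_density s p v z)"
      using assms(3,4) by (auto simp: gagliardo_density_def intro!: divide_right_mono powr_mono2)
  qed (rule measurable_gagliardo_density[OF assms(2)])
  then show ?thesis using assms(2) by (simp add: gagliardo_finite_def)
qed

lemma gagliardo_finite_cmult:
  fixes v :: "'a::euclidean_space \<Rightarrow> real"
  assumes "gagliardo_finite s p v" "0 \<le> c"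
  shows "gagliardo_finite s p (\<lambda>x. c * v x)"
    and "gagliardo_integral s p (\<lambda>x. c * v x) = c powr p * gagliardo_integral s p v"
proof -
  have eq: "gagliardo_density s p (\<lambda>x. c * v x) = (\<lambda>z. c powr p * gagliardo_density s p v z)"
    using assms(2) unfolding gagliardo_density_def
    by (simp add: fun_eq_iff right_diff_distrib[symmetric] abs_mult powr_mult)
  show "gagliardo_finite s p (\<lambda>x. c * v x)"
    using assms unfolding gagliardo_finite_def eq by auto
  show "gagliardo_integral s p (\<lambda>x. c * v x) = c powr p * gagliardo_integral s p v"
    unfolding gagliardo_integral_def eq by simp
qed

text \<open>The sum is at most twice the larger term. The crude constant suffices, since only
  finiteness of the energy of a sum is drawn from it.\<close>

lemma abs_add_powr_le:
  fixes a b :: real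
  assumes "0 < p"
  shows "\<bar>a + b\<bar> powr p \<le> 2 powr p * (\<bar>a\<bar> powr p + \<bar>b\<bar> powr p)"
proof -
  have "\<bar>a + b\<bar> powr p \<le> (2 * max \<bar>a\<bar> \<bar>b\<bar>) powr p"
    using assms by (intro powr_mono2) auto
  also have "\<dots> = 2 powr p * max \<bar>a\<bar> \<bar>b\<bar> powr p"
    by (simp add: powr_mult)
  also have "max \<bar>a\<bar> \<bar>b\<bar> powr p \<le> \<bar>a\<bar> powr p + \<bar>b\<bar> powr p"
    by (simp add: max_def)
  finally show ?thesis by simp
qed

lemma gagliardo_finite_add:
  fixes v w :: "'a::euclidean_space \<Rightarrow> real"
  assumes "gagliardo_finite s p v" "gagliardo_finite s p w" "0 < p"
  shows "gagliardo_finite s p (\<lambda>x. v x + w x)"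
proof -
  have meas: "(\<lambda>x. v x + w x) \<in> borel_measurable lebesgue"
    using assms(1,2) by (auto simp: gagliardo_finite_def)
  have "integrable (lebesgue \<Otimes>\<^sub>M lebesgue) (gagliardo_density s p (\<lambda>x. v x + w x))"
  proof (rule Bochner_Integration.integrable_bound)
    show "integrable (lebesgue \<Otimes>\<^sub>M lebesgue)
        (\<lambda>z. 2 powr p * (gagliardo_density s p v z + gagliardo_density s p w z))"
      using assms(1,2) by (simp add: gagliardo_finite_def)
    show "AE z in lebesgue \<Otimes>\<^sub>M lebesgue. norm (gagliardo_density s p (\<lambda>x. v x + w x) z)
        \<le> norm (2 powr p * (gagliardo_density s p v z + gagliardo_density s p w z))"
    proof (rule AE_I2)
      fix z :: "'a \<times> 'a"
      have "\<bar>v (fst z) + w (fst z) - (v (snd z) + w (snd z))\<bar> powr p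
          \<le> 2 powr p * (\<bar>v (fst z) - v (snd z)\<bar> powr p + \<bar>w (fst z) - w (snd z)\<bar> powr p)"
        using abs_add_powr_le[OF assms(3), of "v (fst z) - v (snd z)" "w (fst z) - w (snd z)"]
        by (simp add: algebra_simps)
      then show "norm (gagliardo_density s p (\<lambda>x. v x + w x) z)
        \<le> norm (2 powr p * (gagliardo_density s p v z + gagliardo_density s p w z))"
        by (simp add: gagliardo_density_nonneg abs_of_nonneg)
          (auto simp: gagliardo_density_def add_divide_distrib[symmetric] intro!: divide_right_mono)
    qed
  qed (rule measurable_gagliardo_density[OF meas])
  then show ?thesis using meas by (simp add: gagliardo_finite_def)
qed

lemma gagliardo_density_diff_commute: "gagliardo_density s p (\<lambda>x. v x - w x) = gagliardo_density s p (\<lambda>x. w x - v x)"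
proof -
  have "\<bar>v x - w x - (v y - w y)\<bar> = \<bar>w x - v x - (w y - v y)\<bar>" for x y by simp
  then show ?thesis by (auto simp: gagliardo_density_def fun_eq_iff)
qed

lemma gagliardo_integral_diff_commute:
  "gagliardo_integral s p (\<lambda>x. v x - w x) = gagliardo_integral s p (\<lambda>x. w x - v x)"
  unfolding gagliardo_integral_def by (subst gagliardo_density_diff_commute) (rule refl)

lemma gagliardo_finite_diff_commute:
  assumes "gagliardo_finite s p (\<lambda>x. v x - w x)"
  shows "gagliardo_finite s p (\<lambda>x. w x - v x)"
proof -
  have "(\<lambda>x. - (v x - w x)) \<in> borel_measurable lebesgue"
    using assms unfolding gagliardo_finite_def by (intro borel_measurable_uminus) auto
  then show ?thesis
    using assms by (simp add: gagliardo_finite_def gagliardo_density_diff_commute[of s p w v])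
qed

section \<open>Hoelder's inequality for the pairing\<close>

lemma pairing_density_eq_powr:
  assumes "1 < p"
  shows "pairing_density s p u v z
     = gagliardo_density s p u z powr (1 - 1 / p) * gagliardo_density s p v z powr (1 - (1 - 1 / p))"
proof -
  define W where "W = norm (fst z - snd z) powr (real DIM('a) + s * p)"
  have W: "0 \<le> W" by (simp add: W_def)
  \<comment> \<open>The singular weight is split between the two factors according to the Hoelder
    exponents, which add up to 1.\<close>
  have "W = W powr (1 - 1 / p) * W powr (1 / p)"
    using W by (simp add: powr_add[symmetric])
  moreover have "p * (1 - 1 / p) = p - 1" using assms by (simp add: field_simps)
  ultimately show ?thesis
    unfolding pairing_density_def gagliardo_density_def W_def[symmetric] using assms W
    by (simp add: powr_divide powr_powr)
qed

lemma pairing_bound_Hoelder: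
  assumes "1 < p" "gagliardo_finite s p u" "gagliardo_finite s p v"
  shows "integrable (lebesgue \<Otimes>\<^sub>M lebesgue) (pairing_density s p u v)"
    and "pairing_bound s p u v
      \<le> gagliardo_integral s p u powr (1 - 1 / p) * gagliardo_integral s p v powr (1 / p)"
proof -
  have t: "0 < 1 - 1 / p" "1 - 1 / p < 1" using assms(1) by auto
  \<comment> \<open>The exponent \<open>1 - (1 - 1 / p)\<close> was left unsimplified so that
    folding matches the product in \<open>Hoelder_powr\<close> literally.\<close>
  note H = Hoelder_powr[of "lebesgue \<Otimes>\<^sub>M lebesgue" "gagliardo_density s p u" "gagliardo_density s p v" "1 - 1/p",
      folded pairing_density_eq_powr[OF assms(1)], OF _ _ t]
  show "integrable (lebesgue \<Otimes>\<^sub>M lebesgue) (pairing_density s p u v)"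
    using H(1) assms(2,3) by (auto simp: gagliardo_finite_def gagliardo_density_nonneg)
  show "pairing_bound s p u v
      \<le> gagliardo_integral s p u powr (1 - 1 / p) * gagliardo_integral s p v powr (1 / p)"
    using H(2) assms(2,3)
    by (auto simp: gagliardo_finite_def gagliardo_density_nonneg gagliardo_integral_def pairing_bound_def)
qed

lemma pairing_bound_mono:
  assumes "1 < p" "gagliardo_finite s p u" "gagliardo_finite s p v" "gagliardo_finite s p w"
    and "\<And>x y. \<bar>w x - w y\<bar> \<le> \<bar>v x - v y\<bar>"
  shows "pairing_bound s p u w \<le> pairing_bound s p u v"
  unfolding pairing_bound_def
proof (rule integral_mono)
  fix z
  show "pairing_density s p u w z \<le> pairing_density s p u v z"
    using assms(5) by (auto simp: pairing_density_def intro!: divide_right_mono mult_left_mono)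
qed (intro pairing_bound_Hoelder assms)+

lemma pairing_bound_add_le:
  assumes "1 < p" "gagliardo_finite s p u" "gagliardo_finite s p v" "gagliardo_finite s p w"
  shows "pairing_bound s p u (\<lambda>x. v x + w x) \<le> pairing_bound s p u v + pairing_bound s p u w"
proof -
  have "pairing_bound s p u (\<lambda>x. v x + w x)
      \<le> (\<integral>z. pairing_density s p u v z + pairing_density s p u w z \<partial>(lebesgue \<Otimes>\<^sub>M lebesgue))"
    unfolding pairing_bound_def
  proof (rule integral_mono)
    fix z
    show "pairing_density s p u (\<lambda>x. v x + w x) z \<le> pairing_density s p u v z + pairing_density s p u w z"
      by (auto simp: pairing_density_def add_divide_distrib[symmetric] distrib_left[symmetric]
          intro!: divide_right_mono mult_left_mono)
  qed (use assms in \<open>auto intro!: pairing_bound_Hoelder Bochner_Integration.integrable_add gagliardo_finite_add\<close>)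
  also have "\<dots> = pairing_bound s p u v + pairing_bound s p u w"
    unfolding pairing_bound_def by (intro Bochner_Integration.integral_add pairing_bound_Hoelder assms)
  finally show ?thesis .
qed

section \<open>The signed pairing\<close>

lemma abs_signed_pairing_density: "\<bar>signed_pairing_density s p u v z\<bar> = pairing_density s p u v z"
proof -
  define d where "d = u (fst z) - u (snd z)"
  \<comment> \<open>This holds also for \<open>d = 0\<close> and \<open>p < 2\<close>, where the
    power is singular on paper: \<open>powr\<close> with base 0 has the value 0.\<close>
  have "\<bar>d\<bar> powr (p - 2) * \<bar>d\<bar> = \<bar>d\<bar> powr (p - 1)"
    using powr_mult_base[of "\<bar>d\<bar>" "p - 2"] by (simp add: mult.commute)
  then show ?thesis
    unfolding signed_pairing_density_def pairing_density_def d_def[symmetric] by (simp add: abs_mult)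
qed

lemma integrable_signed_pairing_density:
  assumes "1 < p" "gagliardo_finite s p u" "gagliardo_finite s p v"
  shows "integrable (lebesgue \<Otimes>\<^sub>M lebesgue) (signed_pairing_density s p u v)"
proof (rule Bochner_Integration.integrable_bound[OF pairing_bound_Hoelder(1)[OF assms]])
  show "signed_pairing_density s p u v \<in> borel_measurable (lebesgue \<Otimes>\<^sub>M lebesgue)"
    using assms by (intro measurable_signed_pairing_density) (auto simp: gagliardo_finite_def)
qed (simp add: abs_signed_pairing_density)

lemma abs_pairing_le:
  "\<bar>frac_p_laplace_pairing s p u v\<bar> \<le> pairing_bound s p u v"
  unfolding frac_p_laplace_pairing_density pairing_bound_def
    abs_signed_pairing_density[symmetric, abs_def] by (rule integral_abs_bound)

lemma pairing_diff:
  assumes "1 < p" "gagliardo_finite s p u" "gagliardo_finite s p v" "gagliardo_finite s p w"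
  shows "frac_p_laplace_pairing s p u (\<lambda>x. v x - w x)
    = frac_p_laplace_pairing s p u v - frac_p_laplace_pairing s p u w"
proof -
  have "signed_pairing_density s p u (\<lambda>x. v x - w x)
      = (\<lambda>z. signed_pairing_density s p u v z - signed_pairing_density s p u w z)"
    by (auto simp: signed_pairing_density_def diff_divide_distrib[symmetric] algebra_simps)
  then show ?thesis
    using integrable_signed_pairing_density[OF assms(1,2)] assms(3,4)
    by (simp add: frac_p_laplace_pairing_density)
qed

lemma pairing_self: "frac_p_laplace_pairing s p u u = gagliardo_integral s p u"
proof -
  have "\<bar>d\<bar> powr (p - 2) * d * d = \<bar>d\<bar> powr p" for d :: real
    using powr_add[of "\<bar>d\<bar>" "p - 2" 2] by (cases "d = 0") (simp_all add: power2_eq_square)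
  then show ?thesis
    by (simp add: frac_p_laplace_pairing_density gagliardo_integral_def
        signed_pairing_density_def[abs_def] gagliardo_density_def[abs_def])
qed

section \<open>Approximation by test functions\<close>

text \<open>The convergence of the p-th power integrals in \<open>Wsp0\<close> is traded for
  convergence almost everywhere, which is what Fatou's lemma asks for. The energies of the errors
  are required to be finite for every index, so that they can be treated as real numbers.\<close>

definition approximated_by ::
    "real \<Rightarrow> real \<Rightarrow> 'a::euclidean_space set \<Rightarrow> ('a \<Rightarrow> real) \<Rightarrow> (nat \<Rightarrow> 'a \<Rightarrow> real) \<Rightarrow> bool" where
  "approximated_by s p \<Omega> v \<phi> \<longleftrightarrow> gagliardo_finite s p v \<and>
     (\<forall>n. \<phi> n \<in> test_functions \<Omega>) \<and>
     (\<forall>n. gagliardo_finite s p (\<lambda>x. \<phi> n x - v x)) \<and>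
     (\<lambda>n. gagliardo_integral s p (\<lambda>x. \<phi> n x - v x)) \<longlonglongrightarrow> 0 \<and>
     (AE x in lebesgue. (\<lambda>n. \<phi> n x) \<longlonglongrightarrow> v x)"

lemma Wsp0_approximated:
  assumes "v \<in> Wsp0 s p \<Omega>" "0 < p"
  obtains \<phi> where "approximated_by s p \<Omega> v \<phi>"
proof -
  obtain \<phi> where test: "\<And>n. \<phi> n \<in> test_functions \<Omega>"
    and lim: "(\<lambda>n. gagliardo_energy s p (\<lambda>x. \<phi> n x - v x)
           + (\<integral>\<^sup>+x. ennreal (\<bar>\<phi> n x - v x\<bar> powr p) \<partial>lebesgue)) \<longlonglongrightarrow> 0"
    using assms(1) by (auto simp: Wsp0_def)
  have v_meas: "v \<in> borel_measurable lebesgue" and v_fin: "gagliardo_finite s p v"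
    using assms(1) by (auto simp: Wsp0_def Wsp_def Lp_def intro: gagliardo_finiteI)
  have meas: "(\<lambda>x. \<phi> n x - v x) \<in> borel_measurable lebesgue" for n
    using v_meas test_functions_measurable[OF test] by (intro borel_measurable_diff)
  define e where "e n = gagliardo_energy s p (\<lambda>x. \<phi> n x - v x)" for n
  define d where "d n = (\<integral>\<^sup>+x. ennreal (\<bar>\<phi> n x - v x\<bar> powr p) \<partial>lebesgue)" for n
  have ed: "(\<lambda>n. e n + d n) \<longlonglongrightarrow> 0" using lim by (simp add: e_def d_def)
  have e_lim: "e \<longlonglongrightarrow> 0" and d_lim: "d \<longlonglongrightarrow> 0"
    by (rule tendsto_sandwich[OF _ _ tendsto_const ed]; simp)+
  \<comment> \<open>Any finite bound would do: dropping the first \<open>N\<close> terms makes every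
    remaining energy and integral finite.\<close>
  have "eventually (\<lambda>n. e n + d n < 1) sequentially"
    using ed by (rule order_tendstoD) simp
  then obtain N where N: "\<And>n. n \<ge> N \<Longrightarrow> e n + d n < 1"
    by (auto simp: eventually_sequentially)
  have small: "e (n + N) < \<infinity>" "d (n + N) < \<infinity>" for n
    using N[of "n + N"] by (auto simp: ennreal_add_less_top less_top[symmetric] top_unique)
  have fin: "gagliardo_finite s p (\<lambda>x. \<phi> (n + N) x - v x)" for n
    using gagliardo_finiteI[OF meas] small(1)[of n] by (simp add: e_def)
  have e_lim': "(\<lambda>n. gagliardo_integral s p (\<lambda>x. \<phi> (n + N) x - v x)) \<longlonglongrightarrow> 0"
    using LIMSEQ_ignore_initial_segment[OF e_lim, of N]
    by (simp add: e_def gagliardo_energy_finite[OF fin] ennreal_tendsto_0_iff gagliardo_integral_nonneg)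
  have powr_meas: "(\<lambda>x. \<bar>\<phi> n x - v x\<bar> powr p) \<in> borel_measurable lebesgue" for n
    using meas by measurable
  have int: "integrable lebesgue (\<lambda>x. \<bar>\<phi> (n + N) x - v x\<bar> powr p)" for n
    using powr_meas small(2)[of n] by (intro integrableI_nonneg) (auto simp: d_def)
  have "d (n + N) = ennreal (\<integral>x. \<bar>\<phi> (n + N) x - v x\<bar> powr p \<partial>lebesgue)" for n
    unfolding d_def by (rule nn_integral_eq_integral[OF int]) simp
  then have "(\<lambda>n. \<integral>x. norm (\<bar>\<phi> (n + N) x - v x\<bar> powr p) \<partial>lebesgue) \<longlonglongrightarrow> 0"
    using LIMSEQ_ignore_initial_segment[OF d_lim, of N]
    by (simp add: ennreal_tendsto_0_iff)
  \<comment> \<open>Convergence in mean yields convergence almost everywhere along a subsequence;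
    the energies converge along it as well.\<close>
  then obtain \<rho> where \<rho>: "strict_mono \<rho>"
    and ae: "AE x in lebesgue. (\<lambda>n. \<bar>\<phi> (\<rho> n + N) x - v x\<bar> powr p) \<longlonglongrightarrow> 0"
    using tendsto_L1_AE_subseq[of lebesgue "\<lambda>n x. \<bar>\<phi> (n + N) x - v x\<bar> powr p", OF int] by blast
  have "AE x in lebesgue. (\<lambda>n. \<phi> (\<rho> n + N) x) \<longlonglongrightarrow> v x"
    using ae
  proof eventually_elim
    case (elim x)
    have "(\<lambda>n. (\<bar>\<phi> (\<rho> n + N) x - v x\<bar> powr p) powr (1 / p)) \<longlonglongrightarrow> 0 powr (1 / p)"
      using elim assms(2) by (intro tendsto_powr') auto
    then have "(\<lambda>n. \<bar>\<phi> (\<rho> n + N) x - v x\<bar>) \<longlonglongrightarrow> 0"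
      using assms(2) by (simp add: powr_powr)
    then show ?case
      by (simp add: tendsto_rabs_zero_iff LIM_zero_iff)
  qed
  then have "approximated_by s p \<Omega> v (\<lambda>n. \<phi> (\<rho> n + N))"
    using test fin v_fin LIMSEQ_subseq_LIMSEQ[OF e_lim' \<rho>]
    by (simp add: approximated_by_def o_def)
  then show thesis by (rule that)
qed

text \<open>Finite energy comes from writing \<open>\<phi> n\<close> as the error plus
  \<open>v\<close>, without estimating the double integral of a test function.\<close>

lemma approximated_by_finite:
  assumes "approximated_by s p \<Omega> v \<phi>" "0 < p"
  shows "gagliardo_finite s p (\<phi> n)"
  using gagliardo_finite_add[of s p "\<lambda>x. \<phi> n x - v x" v] assms
  by (simp add: approximated_by_def)

text \<open>With \<open>k\<close> fixed, the error \<open>\<phi> k - v\<close> is itself a limit of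
  test functions. This allows estimates proved for approximated functions to be applied to the
  error.\<close>

lemma approximated_by_diff:
  assumes "approximated_by s p \<Omega> v \<phi>"
  shows "approximated_by s p \<Omega> (\<lambda>x. \<phi> k x - v x) (\<lambda>n x. \<phi> k x - \<phi> n x)"
proof -
  have "gagliardo_finite s p (\<lambda>x. v x - \<phi> n x)" for n
    using assms by (auto simp: approximated_by_def intro: gagliardo_finite_diff_commute[of s p "\<phi> n" v])
  moreover have "(\<lambda>n. gagliardo_integral s p (\<lambda>x. v x - \<phi> n x)) \<longlonglongrightarrow> 0"
    using assms unfolding approximated_by_def gagliardo_integral_diff_commute[of s p v] by blast
  moreover have "AE x in lebesgue. (\<lambda>n. \<phi> k x - \<phi> n x) \<longlonglongrightarrow> \<phi> k x - v x"
    using assms unfolding approximated_by_def by (auto elim!: eventually_mono intro: tendsto_diff)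
  ultimately show ?thesis
    using assms by (auto simp: approximated_by_def intro: test_functions_diff)
qed

lemma pairing_bound_approximated:
  assumes "1 < p" "gagliardo_finite s p u" "approximated_by s p \<Omega> v \<phi>"
  shows "(\<lambda>n. pairing_bound s p u (\<lambda>x. \<phi> n x - v x)) \<longlonglongrightarrow> 0"
proof (rule tendsto_sandwich[OF _ _ tendsto_const])
  let ?E = "\<lambda>n. gagliardo_integral s p u powr (1 - 1 / p) * gagliardo_integral s p (\<lambda>x. \<phi> n x - v x) powr (1 / p)"
  have "(\<lambda>n. gagliardo_integral s p (\<lambda>x. \<phi> n x - v x) powr (1 / p)) \<longlonglongrightarrow> 0 powr (1 / p)"
    using assms by (intro tendsto_powr') (auto simp: approximated_by_def gagliardo_integral_nonneg)
  then show "?E \<longlonglongrightarrow> 0" using assms(1) by (intro tendsto_mult_right_zero) simp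
  show "eventually (\<lambda>n. pairing_bound s p u (\<lambda>x. \<phi> n x - v x) \<le> ?E n) sequentially"
    using assms by (intro always_eventually allI pairing_bound_Hoelder) (auto simp: approximated_by_def)
  show "eventually (\<lambda>n. 0 \<le> pairing_bound s p u (\<lambda>x. \<phi> n x - v x)) sequentially"
    by (simp add: pairing_bound_def pairing_density_nonneg)
qed

text \<open>Both terms of the approximation error scale with the factor \<open>c powr p\<close>. The
  lemma places the rescaled solution in the space.\<close>

lemma Wsp0_cmult:
  assumes "v \<in> Wsp0 s p \<Omega>" "0 < p" "0 \<le> c"
  shows "(\<lambda>x. c * v x) \<in> Wsp0 s p \<Omega>"
proof -
  have v: "v \<in> borel_measurable lebesgue" "integrable lebesgue (\<lambda>x. \<bar>v x\<bar> powr p)" "gagliardo_finite s p v"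
    using assms(1) by (auto simp: Wsp0_def Wsp_def Lp_def intro: gagliardo_finiteI)
  have scale: "\<bar>c * a\<bar> powr p = c powr p * \<bar>a\<bar> powr p" for a
    using assms(3) by (simp add: abs_mult powr_mult)
  \<comment> \<open>The scaling is stated in \<open>ennreal\<close>, since finiteness of the energy
    of \<open>\<phi> n - v\<close> is not at hand for every \<open>n\<close>.\<close>
  have energy: "gagliardo_energy s p (\<lambda>x. c * w x) = ennreal (c powr p) * gagliardo_energy s p w"
    if "w \<in> borel_measurable lebesgue" for w :: "'a \<Rightarrow> real"
  proof -
    have "gagliardo_density s p (\<lambda>x. c * w x) = (\<lambda>z. c powr p * gagliardo_density s p w z)"
      unfolding gagliardo_density_def
      by (simp add: fun_eq_iff right_diff_distrib[symmetric] scale)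
    then show ?thesis
      unfolding gagliardo_energy_density
      using measurable_gagliardo_density[OF that, of s p]
      by (simp add: ennreal_mult' nn_integral_cmult)
  qed
  obtain \<phi> where test: "\<And>n. \<phi> n \<in> test_functions \<Omega>"
    and lim: "(\<lambda>n. gagliardo_energy s p (\<lambda>x. \<phi> n x - v x)
           + (\<integral>\<^sup>+x. ennreal (\<bar>\<phi> n x - v x\<bar> powr p) \<partial>lebesgue)) \<longlonglongrightarrow> 0"
    using assms(1) by (auto simp: Wsp0_def)
  have meas: "(\<lambda>x. \<phi> n x - v x) \<in> borel_measurable lebesgue" for n
    using v test_functions_measurable[OF test] by (intro borel_measurable_diff)
  have "gagliardo_energy s p (\<lambda>x. c * \<phi> n x - c * v x)
           + (\<integral>\<^sup>+x. ennreal (\<bar>c * \<phi> n x - c * v x\<bar> powr p) \<partial>lebesgue)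
      = ennreal (c powr p) * (gagliardo_energy s p (\<lambda>x. \<phi> n x - v x)
           + (\<integral>\<^sup>+x. ennreal (\<bar>\<phi> n x - v x\<bar> powr p) \<partial>lebesgue))" for n
  proof -
    have powr_meas: "(\<lambda>x. ennreal (\<bar>\<phi> n x - v x\<bar> powr p)) \<in> borel_measurable lebesgue"
      using meas[of n] by measurable
    show ?thesis
      using energy[OF meas[of n]] powr_meas
      by (simp add: right_diff_distrib[symmetric] scale ennreal_mult' nn_integral_cmult distrib_left)
  qed
  moreover have "(\<lambda>n. ennreal (c powr p) * (gagliardo_energy s p (\<lambda>x. \<phi> n x - v x)
           + (\<integral>\<^sup>+x. ennreal (\<bar>\<phi> n x - v x\<bar> powr p) \<partial>lebesgue))) \<longlonglongrightarrow> ennreal (c powr p) * 0"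
    by (rule ennreal_tendsto_cmult[OF _ lim]) simp
  ultimately have "(\<lambda>n. gagliardo_energy s p (\<lambda>x. c * \<phi> n x - c * v x)
           + (\<integral>\<^sup>+x. ennreal (\<bar>c * \<phi> n x - c * v x\<bar> powr p) \<partial>lebesgue)) \<longlonglongrightarrow> 0"
    by simp
  moreover have "(\<lambda>x. c * v x) \<in> Wsp s p"
    using v gagliardo_energy_finite[OF gagliardo_finite_cmult(1)[OF v(3) assms(3)]]
    by (auto simp: Wsp_def Lp_def scale)
  ultimately show ?thesis
    using test_functions_cmult[OF test, of c] unfolding Wsp0_def
    by (intro CollectI conjI exI[of _ "\<lambda>n x. c * \<phi> n x"]) auto
qed

section \<open>Passage from set integrals to the measure restricted to \<Omega>\<close>

lemma set_lebesgue_integral_lebesgue_on: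
  fixes f :: "'a::euclidean_space \<Rightarrow> real"
  assumes "open \<Omega>"
  shows "(LINT x:\<Omega>|lebesgue. f x) = (\<integral>x. f x \<partial>lebesgue_on \<Omega>)"
  using assms by (simp add: set_lebesgue_integral_def integral_restrict_space lborelD)

lemma AE_lebesgue_onI:
  assumes "AE x in lebesgue. x \<in> \<Omega> \<longrightarrow> P x" "open \<Omega>"
  shows "AE x in lebesgue_on \<Omega>. P x"
  using assms by (subst AE_restrict_space_iff) auto

section \<open>Solutions of the singular problem\<close>

locale singular_solution =
  fixes s p \<alpha> :: real and \<Omega> :: "'a::euclidean_space set" and \<omega> u :: "'a \<Rightarrow> real"
  assumes p: "1 < p" and \<alpha>: "0 < \<alpha>" "\<alpha> < 1" and \<Omega>: "open \<Omega>"
    and \<omega>_integrable: "integrable (lebesgue_on \<Omega>) \<omega>"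
    and \<omega>_nonneg: "AE x in lebesgue_on \<Omega>. 0 \<le> \<omega> x"
    and \<omega>_nonzero: "\<not> (AE x in lebesgue_on \<Omega>. \<omega> x = 0)"
    and solution: "weak_solution s p \<alpha> \<Omega> \<omega> u"
begin

lemma u_Wsp0: "u \<in> Wsp0 s p \<Omega>"
  using solution by (simp add: weak_solution_def)

lemma u_finite: "gagliardo_finite s p u"
  using Wsp0_approximated[OF u_Wsp0] p by (auto simp: approximated_by_def)

lemma u_measurable: "u \<in> borel_measurable (lebesgue_on \<Omega>)"
  using u_finite by (intro measurable_restrict_space1) (simp add: gagliardo_finite_def)

lemma equation:
  assumes "\<phi> \<in> test_functions \<Omega>"
  shows "frac_p_laplace_pairing s p u \<phi> = (\<integral>x. \<omega> x * \<phi> x / u x powr \<alpha> \<partial>lebesgue_on \<Omega>)"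
  using solution assms set_lebesgue_integral_lebesgue_on[OF \<Omega>] by (simp add: weak_solution_def)

text \<open>A weak solution is bounded below on subdomains, which are connected, while
  \<open>K\<close> may be any compact set. Finitely many balls with closure in \<Omega> cover
  \<open>K\<close>, and the smallest of their constants works.\<close>

lemma u_bounded_below_on_compact:
  assumes "compact K" "K \<subseteq> \<Omega>"
  obtains C where "0 < C" "AE x in lebesgue. x \<in> K \<longrightarrow> C \<le> u x"
proof -
  have "\<exists>e>0. cball z e \<subseteq> \<Omega>" if "z \<in> K" for z
    using \<Omega> that assms(2) by (auto simp: open_contains_cball)
  then obtain e where e: "\<And>z. z \<in> K \<Longrightarrow> 0 < e z" "\<And>z. z \<in> K \<Longrightarrow> cball z (e z) \<subseteq> \<Omega>"
    by metis
  have "\<exists>C>0. AE x in lebesgue. x \<in> ball z (e z) \<longrightarrow> C \<le> u x" if "z \<in> K" for z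
  proof -
    have "is_domain (ball z (e z)) \<and> compact (closure (ball z (e z))) \<and> closure (ball z (e z)) \<subseteq> \<Omega>"
      using e[OF that] by (auto simp: is_domain_def)
    then show ?thesis using solution unfolding weak_solution_def by blast
  qed
  then obtain C where C: "\<And>z. z \<in> K \<Longrightarrow> 0 < C z"
      "\<And>z. z \<in> K \<Longrightarrow> AE x in lebesgue. x \<in> ball z (e z) \<longrightarrow> C z \<le> u x"
    by metis
  have cover: "K \<subseteq> (\<Union>z\<in>K. ball z (e z))"
    using e(1) by (intro subsetI UN_I) auto
  obtain D where D: "D \<subseteq> K" "finite D" "K \<subseteq> (\<Union>z\<in>D. ball z (e z))"
    by (rule compactE_image[where f = "\<lambda>z. ball z (e z)", OF assms(1) open_ball cover])
  \<comment> \<open>Inserting 1 keeps the minimum meaningful when \<open>D\<close> is empty and does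
    not affect positivity.\<close>
  define m where "m = Min (insert 1 (C ` D))"
  have "0 < m" using D C(1) by (auto simp: m_def)
  have m_le: "m \<le> C z" if "z \<in> D" for z using D(2) that by (simp add: m_def)
  have "AE x in lebesgue. \<forall>z\<in>D. x \<in> ball z (e z) \<longrightarrow> C z \<le> u x"
    using D C(2) by (intro AE_finite_allI) auto
  then have "AE x in lebesgue. x \<in> K \<longrightarrow> m \<le> u x"
  proof eventually_elim
    case (elim x)
    show ?case
    proof
      assume "x \<in> K"
      then obtain z where z: "z \<in> D" "x \<in> ball z (e z)" using D(3) by blast
      with elim have "C z \<le> u x" by blast
      with m_le[OF z(1)] show "m \<le> u x" by (rule order_trans)
    qed
  qed
  with \<open>0 < m\<close> show thesis by (rule that)
qed

text \<open>The open set is a countable union of compact sets, on each of which \<open>u\<close> has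
  a positive lower bound; countably many null sets are discarded.\<close>

lemma u_pos: "AE x in lebesgue_on \<Omega>. 0 < u x"
proof (rule AE_lebesgue_onI[OF _ \<Omega>])
  obtain K :: "nat \<Rightarrow> 'a set" where K: "\<And>n. compact (K n)" "\<And>n. K n \<subseteq> \<Omega>" "\<Union> (range K) = \<Omega>"
  proof (rule open_Union_compact_subsets[OF \<Omega>])
    fix C :: "nat \<Rightarrow> 'a set"
    assume "\<And>n. compact (C n)" "\<And>n. C n \<subseteq> \<Omega>" "\<Union> (range C) = \<Omega>"
    then show thesis by (rule that)
  qed
  have "AE x in lebesgue. x \<in> K n \<longrightarrow> 0 < u x" for n
  proof -
    obtain C where "0 < C" "AE x in lebesgue. x \<in> K n \<longrightarrow> C \<le> u x"
      using u_bounded_below_on_compact[OF K(1,2)[of n]] by blast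
    then show ?thesis by (auto elim!: eventually_mono)
  qed
  then have "AE x in lebesgue. \<forall>n. x \<in> K n \<longrightarrow> 0 < u x"
    unfolding AE_all_countable by (rule allI)
  then show "AE x in lebesgue. x \<in> \<Omega> \<longrightarrow> 0 < u x"
  proof (rule eventually_mono)
    fix x
    assume pos: "\<forall>n. x \<in> K n \<longrightarrow> 0 < u x"
    show "x \<in> \<Omega> \<longrightarrow> 0 < u x"
    proof
      assume "x \<in> \<Omega>"
      then obtain n where "x \<in> K n" unfolding K(3)[symmetric] by blast
      then show "0 < u x" using pos by blast
    qed
  qed
qed

section \<open>The singular term tested with test functions\<close>

lemma measurable_on_\<Omega>: "\<phi> \<in> borel_measurable lebesgue \<Longrightarrow> \<phi> \<in> borel_measurable (lebesgue_on \<Omega>)"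
  by (rule measurable_restrict_space1)

lemma singular_term_measurable:
  assumes "v \<in> borel_measurable lebesgue"
  shows "(\<lambda>x. \<omega> x * v x / u x powr \<alpha>) \<in> borel_measurable (lebesgue_on \<Omega>)"
proof -
  note [measurable] = u_measurable measurable_on_\<Omega>[OF assms] borel_measurable_integrable[OF \<omega>_integrable]
  show ?thesis by measurable
qed

text \<open>On the support of \<open>\<phi>\<close> the solution is at least some
  \<open>C > 0\<close> and \<open>\<phi>\<close> is bounded, so a multiple of \<omega> is a
  majorant. Off the support the integrand is 0.\<close>

lemma singular_term_integrable:
  assumes "\<phi> \<in> test_functions \<Omega>"
  shows "integrable (lebesgue_on \<Omega>) (\<lambda>x. \<omega> x * \<phi> x / u x powr \<alpha>)"
proof -
  let ?S = "closure {x. \<phi> x \<noteq> 0}"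
  have S: "compact ?S" "?S \<subseteq> \<Omega>" using assms by (auto simp: test_functions_def)
  obtain C where C: "0 < C" "AE x in lebesgue. x \<in> ?S \<longrightarrow> C \<le> u x"
    using u_bounded_below_on_compact[OF S] by blast
  have "compact (\<phi> ` ?S)"
    by (rule compact_continuous_image[OF continuous_on_subset[OF test_functions_continuous[OF assms]] S(1)]) simp
  then have "bounded (\<phi> ` ?S)" by (rule compact_imp_bounded)
  then obtain B where "\<forall>y\<in>\<phi> ` ?S. norm y \<le> B"
    unfolding bounded_iff by blast
  then have B: "\<bar>\<phi> x\<bar> \<le> B" if "x \<in> ?S" for x
    using that by simp
  show ?thesis
  proof (rule Bochner_Integration.integrable_bound)
    show "integrable (lebesgue_on \<Omega>) (\<lambda>x. (B / C powr \<alpha>) * \<omega> x)"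
      using \<omega>_integrable by simp
    show "(\<lambda>x. \<omega> x * \<phi> x / u x powr \<alpha>) \<in> borel_measurable (lebesgue_on \<Omega>)"
      by (intro singular_term_measurable test_functions_measurable[OF assms])
    have "AE x in lebesgue_on \<Omega>. x \<in> ?S \<longrightarrow> C \<le> u x"
      by (rule AE_lebesgue_onI[OF _ \<Omega>]) (use C(2) in \<open>auto elim: eventually_mono\<close>)
    then show "AE x in lebesgue_on \<Omega>. norm (\<omega> x * \<phi> x / u x powr \<alpha>) \<le> norm ((B / C powr \<alpha>) * \<omega> x)"
    proof (rule eventually_mono)
      fix x
      assume low: "x \<in> ?S \<longrightarrow> C \<le> u x"
      show "norm (\<omega> x * \<phi> x / u x powr \<alpha>) \<le> norm ((B / C powr \<alpha>) * \<omega> x)"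
      proof (cases "\<phi> x = 0")
        case False
        then have x: "x \<in> ?S" using closure_subset[of "{x. \<phi> x \<noteq> 0}"] by (simp add: subset_iff)
        have bounds: "0 < C powr \<alpha>" "C powr \<alpha> \<le> u x powr \<alpha>"
          using x low C(1) \<alpha> by (simp_all add: powr_mono2)
        have "\<bar>\<phi> x\<bar> / u x powr \<alpha> \<le> \<bar>B\<bar> / C powr \<alpha>"
          by (rule frac_le[OF _ _ bounds]) (use B[OF x] in linarith)+
        then have "\<bar>\<omega> x\<bar> * (\<bar>\<phi> x\<bar> / u x powr \<alpha>) \<le> \<bar>\<omega> x\<bar> * (\<bar>B\<bar> / C powr \<alpha>)"
          by (rule mult_left_mono) simp
        then show ?thesis by (simp add: abs_mult mult.commute[of "\<bar>\<omega> x\<bar>"])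
      qed simp
    qed
  qed
qed

lemma singular_term_abs_integrable:
  assumes "\<phi> \<in> test_functions \<Omega>"
  shows "integrable (lebesgue_on \<Omega>) (\<lambda>x. \<omega> x * \<bar>\<phi> x\<bar> / u x powr \<alpha>)"
proof (rule Bochner_Integration.integrable_bound[OF singular_term_integrable[OF assms]])
  show "(\<lambda>x. \<omega> x * \<bar>\<phi> x\<bar> / u x powr \<alpha>) \<in> borel_measurable (lebesgue_on \<Omega>)"
    by (intro singular_term_measurable borel_measurable_abs test_functions_measurable[OF assms])
qed (simp add: abs_mult)

text \<open>The absolute value of \<open>\<phi>\<close> need not be smooth, so the equation is used
  for its regularisations. Their pairings are controlled by the increments of \<open>\<phi>\<close>,
  and the right-hand sides converge by dominated convergence.\<close>

lemma singular_term_test_le: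
  assumes "\<phi> \<in> test_functions \<Omega>" "gagliardo_finite s p \<phi>"
  shows "(\<integral>x. \<omega> x * \<bar>\<phi> x\<bar> / u x powr \<alpha> \<partial>lebesgue_on \<Omega>) \<le> pairing_bound s p u \<phi>"
proof -
  define \<epsilon> where "\<epsilon> n = 1 / real (Suc n)" for n
  define \<psi> where "\<psi> n x = sqrt ((\<phi> x)\<^sup>2 + (\<epsilon> n)\<^sup>2) - \<epsilon> n" for n x
  have \<epsilon>: "0 < \<epsilon> n" for n by (simp add: \<epsilon>_def)
  have test: "\<psi> n \<in> test_functions \<Omega>" for n
    unfolding \<psi>_def[abs_def] by (rule test_functions_sqrt_regularisation[OF assms(1) \<epsilon>])
  have lip: "\<bar>\<psi> n x - \<psi> n y\<bar> \<le> \<bar>\<phi> x - \<phi> y\<bar>" for n x y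
    unfolding \<psi>_def by (rule sqrt_regularisation_lipschitz)
  have le: "\<bar>\<psi> n x\<bar> \<le> \<bar>\<phi> x\<bar>" for n x
    \<comment> \<open>The comparison point 0 is a zero of the regularisation, so the Lipschitz bound
      becomes a pointwise bound.\<close>
    using sqrt_regularisation_lipschitz[of "\<phi> x" "\<epsilon> n" 0] \<epsilon>[of n] by (simp add: \<psi>_def)
  have fin: "gagliardo_finite s p (\<psi> n)" for n
    using p lip by (intro gagliardo_finite_lipschitz[OF assms(2) test_functions_measurable[OF test]]) auto
  have "(\<lambda>n. \<integral>x. \<omega> x * \<psi> n x / u x powr \<alpha> \<partial>lebesgue_on \<Omega>)
      \<longlonglongrightarrow> (\<integral>x. \<omega> x * \<bar>\<phi> x\<bar> / u x powr \<alpha> \<partial>lebesgue_on \<Omega>)"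
  proof (rule integral_dominated_convergence)
    show "integrable (lebesgue_on \<Omega>) (\<lambda>x. \<bar>\<omega> x * \<bar>\<phi> x\<bar> / u x powr \<alpha>\<bar>)"
      using singular_term_abs_integrable[OF assms(1)] by (rule integrable_abs)
    show "AE x in lebesgue_on \<Omega>. norm (\<omega> x * \<psi> n x / u x powr \<alpha>) \<le> \<bar>\<omega> x * \<bar>\<phi> x\<bar> / u x powr \<alpha>\<bar>" for n
      using le[of n] by (auto simp: abs_mult intro!: divide_right_mono mult_left_mono)
    have "\<epsilon> \<longlonglongrightarrow> 0"
      unfolding \<epsilon>_def[abs_def] using LIMSEQ_inverse_real_of_nat by (simp add: inverse_eq_divide)
    then have "(\<lambda>n. \<psi> n x) \<longlonglongrightarrow> sqrt ((\<phi> x)\<^sup>2 + 0\<^sup>2) - 0" for x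
      unfolding \<psi>_def by (intro tendsto_intros)
    then have lim: "(\<lambda>n. \<psi> n x) \<longlonglongrightarrow> \<bar>\<phi> x\<bar>" for x by simp
    then show "AE x in lebesgue_on \<Omega>. (\<lambda>n. \<omega> x * \<psi> n x / u x powr \<alpha>) \<longlonglongrightarrow> \<omega> x * \<bar>\<phi> x\<bar> / u x powr \<alpha>"
      unfolding divide_inverse by (intro AE_I2 tendsto_mult_right tendsto_mult_left lim)
  qed (intro singular_term_measurable borel_measurable_abs test_functions_measurable[OF test]
      test_functions_measurable[OF assms(1)])+
  moreover have "(\<integral>x. \<omega> x * \<psi> n x / u x powr \<alpha> \<partial>lebesgue_on \<Omega>) \<le> pairing_bound s p u \<phi>" for n
    using equation[OF test[of n]] abs_pairing_le[of s p u "\<psi> n"]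
      pairing_bound_mono[OF p u_finite assms(2) fin[of n] lip] by linarith
  ultimately show ?thesis by (intro LIMSEQ_le_const2) auto
qed

text \<open>Fatou's lemma passes from \<open>\<phi> n\<close> to \<open>v\<close>. By subadditivity
  the bounds for \<open>\<phi> n\<close> exceed that for \<open>v\<close> at most by the pairing
  bound of the error, which tends to 0.\<close>

lemma singular_term_approximated_le:
  assumes "approximated_by s p \<Omega> v \<phi>"
  shows "integrable (lebesgue_on \<Omega>) (\<lambda>x. \<omega> x * \<bar>v x\<bar> / u x powr \<alpha>)"
    and "(\<integral>x. \<omega> x * \<bar>v x\<bar> / u x powr \<alpha> \<partial>lebesgue_on \<Omega>) \<le> pairing_bound s p u v"
proof -
  let ?f = "\<lambda>v x. \<omega> x * \<bar>v x\<bar> / u x powr \<alpha>"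
  have test: "\<phi> n \<in> test_functions \<Omega>" and fin: "gagliardo_finite s p v"
    "gagliardo_finite s p (\<lambda>x. \<phi> n x - v x)" for n
    using assms by (auto simp: approximated_by_def)
  have meas: "?f v \<in> borel_measurable (lebesgue_on \<Omega>)" "?f (\<phi> n) \<in> borel_measurable (lebesgue_on \<Omega>)" for n
    using fin(1) test_functions_measurable[OF test]
    by (auto intro!: singular_term_measurable simp: gagliardo_finite_def)
  have nonneg: "AE x in lebesgue_on \<Omega>. 0 \<le> ?f w x" for w
    using \<omega>_nonneg by (auto elim!: eventually_mono)
  have bound: "(\<integral>\<^sup>+x. ennreal (?f (\<phi> n) x) \<partial>lebesgue_on \<Omega>)
      \<le> ennreal (pairing_bound s p u v + pairing_bound s p u (\<lambda>x. \<phi> n x - v x))" for n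
  proof -
    have "(\<integral>\<^sup>+x. ennreal (?f (\<phi> n) x) \<partial>lebesgue_on \<Omega>) = ennreal (\<integral>x. ?f (\<phi> n) x \<partial>lebesgue_on \<Omega>)"
      by (rule nn_integral_eq_integral[OF singular_term_abs_integrable[OF test] nonneg])
    also have "\<dots> \<le> ennreal (pairing_bound s p u (\<phi> n))"
      using p by (intro ennreal_leI singular_term_test_le test approximated_by_finite[OF assms]) auto
    also have "\<dots> \<le> ennreal (pairing_bound s p u v + pairing_bound s p u (\<lambda>x. \<phi> n x - v x))"
      using pairing_bound_add_le[OF p u_finite fin(1) fin(2)[of n]] by (intro ennreal_leI) simp
    finally show ?thesis .
  qed
  have lim: "(\<lambda>n. ennreal (pairing_bound s p u v + pairing_bound s p u (\<lambda>x. \<phi> n x - v x)))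
      \<longlonglongrightarrow> ennreal (pairing_bound s p u v + 0)"
    by (intro tendsto_ennrealI tendsto_add tendsto_const pairing_bound_approximated[OF p u_finite assms])
  have "AE x in lebesgue_on \<Omega>. (\<lambda>n. \<phi> n x) \<longlonglongrightarrow> v x"
    by (rule AE_lebesgue_onI[OF _ \<Omega>]) (use assms in \<open>auto simp: approximated_by_def elim: eventually_mono\<close>)
  then have "AE x in lebesgue_on \<Omega>. ennreal (?f v x) = liminf (\<lambda>n. ennreal (?f (\<phi> n) x))"
  proof eventually_elim
    case (elim x)
    have "(\<lambda>n. ennreal (?f (\<phi> n) x)) \<longlonglongrightarrow> ennreal (?f v x)"
      unfolding divide_inverse
      by (intro tendsto_ennrealI tendsto_mult_right tendsto_mult_left tendsto_rabs elim)
    then show ?case by (simp add: lim_imp_Liminf)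
  qed
  \<comment> \<open>Working with extended nonnegative integrals gives integrability for
    \<open>v\<close> and the estimate at the same time.\<close>
  then have "(\<integral>\<^sup>+x. ennreal (?f v x) \<partial>lebesgue_on \<Omega>)
      = (\<integral>\<^sup>+x. liminf (\<lambda>n. ennreal (?f (\<phi> n) x)) \<partial>lebesgue_on \<Omega>)"
    by (rule nn_integral_cong_AE)
  also have "\<dots> \<le> liminf (\<lambda>n. \<integral>\<^sup>+x. ennreal (?f (\<phi> n) x) \<partial>lebesgue_on \<Omega>)"
    by (intro nn_integral_liminf measurable_compose[OF meas(2) measurable_ennreal])
  also have "\<dots> \<le> liminf (\<lambda>n. ennreal (pairing_bound s p u v + pairing_bound s p u (\<lambda>x. \<phi> n x - v x)))"
    by (intro Liminf_mono always_eventually allI bound)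
  also have "\<dots> = ennreal (pairing_bound s p u v)"
    using lim_imp_Liminf[OF _ lim] by simp
  finally have le: "(\<integral>\<^sup>+x. ennreal (?f v x) \<partial>lebesgue_on \<Omega>) \<le> ennreal (pairing_bound s p u v)" .
  then show int: "integrable (lebesgue_on \<Omega>) (?f v)"
    by (intro integrableI_nonneg meas nonneg) (auto simp: less_top[symmetric] top_unique)
  have "0 \<le> pairing_bound s p u v"
    by (simp add: pairing_bound_def pairing_density_nonneg)
  then show "(\<integral>x. ?f v x \<partial>lebesgue_on \<Omega>) \<le> pairing_bound s p u v"
    using le by (simp add: nn_integral_eq_integral[OF int nonneg])
qed

text \<open>The equation tested with \<open>\<phi> n\<close> is compared with the same expression
  for \<open>u\<close>. On each side the error is at most the pairing bound of
  \<open>\<phi> n - u\<close>, which explains the factor 2 in the estimate and makes both errors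
  vanish in the limit.\<close>

lemma energy_identity:
  shows "integrable (lebesgue_on \<Omega>) (\<lambda>x. \<omega> x * \<bar>u x\<bar> powr (1 - \<alpha>))"
    and "(\<integral>x. \<omega> x * \<bar>u x\<bar> powr (1 - \<alpha>) \<partial>lebesgue_on \<Omega>) = gagliardo_integral s p u"
proof -
  let ?f = "\<lambda>v x. \<omega> x * v x / u x powr \<alpha>"
  let ?I = "\<lambda>v. \<integral>x. \<omega> x * v x / u x powr \<alpha> \<partial>lebesgue_on \<Omega>"
  obtain \<phi> where \<phi>: "approximated_by s p \<Omega> u \<phi>"
    using Wsp0_approximated[OF u_Wsp0] p by auto
  note test = \<phi>[unfolded approximated_by_def, THEN conjunct2, THEN conjunct1, rule_format]
  have eq: "AE x in lebesgue_on \<Omega>. \<omega> x * \<bar>u x\<bar> powr (1 - \<alpha>) = ?f u x"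
    using u_pos by eventually_elim (simp add: powr_diff)
  have eq': "AE x in lebesgue_on \<Omega>. \<omega> x * \<bar>u x\<bar> / u x powr \<alpha> = ?f u x"
    using u_pos by eventually_elim simp
  have u_meas: "u \<in> borel_measurable lebesgue" using u_finite by (simp add: gagliardo_finite_def)
  note [measurable] = u_measurable singular_term_measurable[OF u_meas]
    singular_term_measurable[OF borel_measurable_abs[OF u_meas]] borel_measurable_integrable[OF \<omega>_integrable]
  have int_u: "integrable (lebesgue_on \<Omega>) (?f u)"
    using singular_term_approximated_le(1)[OF \<phi>] integrable_cong_AE[OF _ _ eq'] by simp
  then show "integrable (lebesgue_on \<Omega>) (\<lambda>x. \<omega> x * \<bar>u x\<bar> powr (1 - \<alpha>))"
    using integrable_cong_AE[OF _ _ eq] by simp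
  have le: "\<bar>gagliardo_integral s p u - ?I u\<bar> \<le> 2 * pairing_bound s p u (\<lambda>x. \<phi> n x - u x)" for n
  proof -
    have fin: "gagliardo_finite s p (\<phi> n)"
      using approximated_by_finite[OF \<phi>] p by auto
    have "frac_p_laplace_pairing s p u (\<phi> n) - gagliardo_integral s p u
        = frac_p_laplace_pairing s p u (\<lambda>x. \<phi> n x - u x)"
      by (simp add: pairing_diff[OF p u_finite fin u_finite] pairing_self)
    then have 1: "\<bar>frac_p_laplace_pairing s p u (\<phi> n) - gagliardo_integral s p u\<bar>
        \<le> pairing_bound s p u (\<lambda>x. \<phi> n x - u x)"
      by (simp add: abs_pairing_le)
    have "?I (\<phi> n) - ?I u = (\<integral>x. ?f (\<lambda>x. \<phi> n x - u x) x \<partial>lebesgue_on \<Omega>)"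
      using singular_term_integrable[OF test] int_u
      by (subst Bochner_Integration.integral_diff[symmetric])
        (simp_all add: right_diff_distrib diff_divide_distrib)
    also have "\<bar>\<dots>\<bar> \<le> (\<integral>x. \<bar>?f (\<lambda>x. \<phi> n x - u x) x\<bar> \<partial>lebesgue_on \<Omega>)"
      by (rule integral_abs_bound)
    also have "\<dots> = (\<integral>x. \<omega> x * \<bar>\<phi> n x - u x\<bar> / u x powr \<alpha> \<partial>lebesgue_on \<Omega>)"
    proof (rule integral_cong_AE)
      have d: "(\<lambda>x. \<phi> n x - u x) \<in> borel_measurable lebesgue"
        using test_functions_measurable[OF test] u_meas by (rule borel_measurable_diff)
      show "(\<lambda>x. \<bar>?f (\<lambda>x. \<phi> n x - u x) x\<bar>) \<in> borel_measurable (lebesgue_on \<Omega>)"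
        by (intro borel_measurable_abs singular_term_measurable d)
      show "(\<lambda>x. \<omega> x * \<bar>\<phi> n x - u x\<bar> / u x powr \<alpha>) \<in> borel_measurable (lebesgue_on \<Omega>)"
        by (intro borel_measurable_abs singular_term_measurable d)
      show "AE x in lebesgue_on \<Omega>. \<bar>?f (\<lambda>x. \<phi> n x - u x) x\<bar> = \<omega> x * \<bar>\<phi> n x - u x\<bar> / u x powr \<alpha>"
        using \<omega>_nonneg by eventually_elim (simp add: abs_mult)
    qed
    also have "\<dots> \<le> pairing_bound s p u (\<lambda>x. \<phi> n x - u x)"
      by (rule singular_term_approximated_le(2)[OF approximated_by_diff[OF \<phi>]])
    finally show ?thesis using 1 equation[OF test[of n]] by linarith
  qed
  have lim: "(\<lambda>n. 2 * pairing_bound s p u (\<lambda>x. \<phi> n x - u x)) \<longlonglongrightarrow> 2 * 0"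
    by (intro tendsto_mult_left pairing_bound_approximated[OF p u_finite \<phi>])
  have "\<bar>gagliardo_integral s p u - ?I u\<bar> \<le> 2 * 0"
    by (rule LIMSEQ_le_const[OF lim]) (use le in blast)
  then show "(\<integral>x. \<omega> x * \<bar>u x\<bar> powr (1 - \<alpha>) \<partial>lebesgue_on \<Omega>) = gagliardo_integral s p u"
    using integral_cong_AE[OF _ _ eq] by simp
qed

text \<open>Zero energy would force the weighted integral of the positive function \<open>u\<close>
  to vanish, hence \<omega> = 0 almost everywhere. Positivity is what permits negative powers of the
  energy below.\<close>

lemma gagliardo_integral_pos: "0 < gagliardo_integral s p u"
proof (rule ccontr)
  assume "\<not> ?thesis"
  then have "(\<integral>x. \<omega> x * \<bar>u x\<bar> powr (1 - \<alpha>) \<partial>lebesgue_on \<Omega>) = 0"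
    using energy_identity(2) gagliardo_integral_nonneg[of s p u] by simp
  moreover have "AE x in lebesgue_on \<Omega>. 0 \<le> \<omega> x * \<bar>u x\<bar> powr (1 - \<alpha>)"
    using \<omega>_nonneg by (auto elim!: eventually_mono)
  ultimately have "AE x in lebesgue_on \<Omega>. \<omega> x * \<bar>u x\<bar> powr (1 - \<alpha>) = 0"
    using integral_nonneg_eq_0_iff_AE[OF energy_identity(1)] by blast
  then have "AE x in lebesgue_on \<Omega>. \<omega> x = 0"
    using u_pos by eventually_elim simp
  then show False using \<omega>_nonzero by simp
qed

section \<open>The lower bound on the constraint set\<close>

lemma constraint_integral_le:
  assumes "v \<in> Wsp0 s p \<Omega>"
  shows "(\<integral>x. \<bar>v x\<bar> powr (1 - \<alpha>) * \<omega> x \<partial>lebesgue_on \<Omega>)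
    \<le> gagliardo_integral s p u powr ((p - 1 + \<alpha>) / p) * gagliardo_integral s p v powr ((1 - \<alpha>) / p)"
proof -
  obtain \<phi> where \<phi>: "approximated_by s p \<Omega> v \<phi>"
    using Wsp0_approximated[OF assms] p by auto
  then have fin: "gagliardo_finite s p v" by (simp add: approximated_by_def)
  let ?E = "gagliardo_integral s p u" and ?F = "gagliardo_integral s p v"
  let ?f = "\<lambda>x. \<omega> x * \<bar>v x\<bar> / u x powr \<alpha>" and ?g = "\<lambda>x. \<omega> x * \<bar>u x\<bar> powr (1 - \<alpha>)"
  note f = singular_term_approximated_le[OF \<phi>]
  have nonneg: "AE x in lebesgue_on \<Omega>. 0 \<le> ?f x" "AE x in lebesgue_on \<Omega>. 0 \<le> ?g x"
    using \<omega>_nonneg by (auto elim!: eventually_mono)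
  \<comment> \<open>The powers of \<open>u\<close> cancel, with exponents
    \<open>- \<alpha> * (1 - \<alpha>)\<close> and \<open>(1 - \<alpha>) * \<alpha>\<close>, while
    those of \<omega> add up to 1.\<close>
  have eq: "AE x in lebesgue_on \<Omega>. \<bar>v x\<bar> powr (1 - \<alpha>) * \<omega> x = ?f x powr (1 - \<alpha>) * ?g x powr (1 - (1 - \<alpha>))"
    using \<omega>_nonneg u_pos
  proof eventually_elim
    case (elim x)
    have "\<omega> x powr (1 - \<alpha>) * \<omega> x powr \<alpha> = \<omega> x"
      using elim by (simp add: powr_add[symmetric])
    then show ?case
      using elim by (simp add: powr_mult powr_divide powr_powr algebra_simps)
  qed
  have v_meas: "v \<in> borel_measurable lebesgue" using fin by (simp add: gagliardo_finite_def)
  note [measurable] = u_measurable measurable_on_\<Omega>[OF v_meas] borel_measurable_integrable[OF \<omega>_integrable]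
  have "(\<integral>x. \<bar>v x\<bar> powr (1 - \<alpha>) * \<omega> x \<partial>lebesgue_on \<Omega>)
      = (\<integral>x. ?f x powr (1 - \<alpha>) * ?g x powr (1 - (1 - \<alpha>)) \<partial>lebesgue_on \<Omega>)"
    by (rule integral_cong_AE[OF _ _ eq]) measurable
  also have "\<dots> \<le> (\<integral>x. ?f x \<partial>lebesgue_on \<Omega>) powr (1 - \<alpha>) * ?E powr (1 - (1 - \<alpha>))"
    using Hoelder_powr(2)[OF f(1) energy_identity(1) _ _ nonneg, of "1 - \<alpha>"] \<alpha> energy_identity(2) by simp
  also have "\<dots> \<le> (?E powr (1 - 1 / p) * ?F powr (1 / p)) powr (1 - \<alpha>) * ?E powr (1 - (1 - \<alpha>))"
    using f(2) pairing_bound_Hoelder(2)[OF p u_finite fin] integral_nonneg_AE[OF nonneg(1)] \<alpha>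
    by (intro mult_right_mono powr_mono2) auto
  also have "\<dots> = ?E powr ((1 - 1 / p) * (1 - \<alpha>) + \<alpha>) * ?F powr ((1 - \<alpha>) / p)"
    by (simp add: powr_mult powr_powr powr_add)
  also have "(1 - 1 / p) * (1 - \<alpha>) + \<alpha> = (p - 1 + \<alpha>) / p"
    using p by (simp add: field_simps)
  finally show ?thesis .
qed

lemma gagliardo_powr:
  assumes "gagliardo_finite s p v"
  shows "gagliardo s p v powr p = gagliardo_integral s p v"
  using p by (simp add: gagliardo_eq_powr[OF assms] powr_powr gagliardo_integral_nonneg)

lemma constraint_energy_ge:
  assumes "v \<in> constraint_set s p \<alpha> \<Omega> \<omega>"
  shows "gagliardo_integral s p u powr ((1 - \<alpha> - p) / (1 - \<alpha>)) \<le> gagliardo_integral s p v"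
proof -
  let ?E = "gagliardo_integral s p u" and ?F = "gagliardo_integral s p v"
  have v: "v \<in> Wsp0 s p \<Omega>" "(\<integral>x. \<bar>v x\<bar> powr (1 - \<alpha>) * \<omega> x \<partial>lebesgue_on \<Omega>) = 1"
    using assms by (auto simp: constraint_set_def set_lebesgue_integral_lebesgue_on[OF \<Omega>])
  have "1 \<le> ?E powr ((p - 1 + \<alpha>) / p) * ?F powr ((1 - \<alpha>) / p)"
    using constraint_integral_le[OF v(1)] v(2) by simp
  \<comment> \<open>This exponent is chosen so that the energy of \<open>v\<close> appears to the
    first power.\<close>
  then have "1 powr (p / (1 - \<alpha>)) \<le> (?E powr ((p - 1 + \<alpha>) / p) * ?F powr ((1 - \<alpha>) / p)) powr (p / (1 - \<alpha>))"
    using p \<alpha> by (intro powr_mono2) auto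
  also have "\<dots> = ?E powr ((p - 1 + \<alpha>) / (1 - \<alpha>)) * ?F"
    using p \<alpha> gagliardo_integral_nonneg[of s p v] by (simp add: powr_mult powr_powr)
  finally have *: "1 \<le> ?E powr ((p - 1 + \<alpha>) / (1 - \<alpha>)) * ?F" by simp
  have "(1 - \<alpha> - p) / (1 - \<alpha>) = - ((p - 1 + \<alpha>) / (1 - \<alpha>))"
    using \<alpha> by (simp add: field_simps)
  then show ?thesis
    using * gagliardo_integral_pos by (simp only: powr_minus) (simp add: field_simps)
qed

section \<open>The rescaled solution\<close>

lemma theta_eq: "theta \<alpha> \<Omega> \<omega> u = gagliardo_integral s p u powr (- 1 / (1 - \<alpha>))"
  unfolding theta_def set_lebesgue_integral_lebesgue_on[OF \<Omega>]
  using energy_identity(2) by (simp add: mult.commute)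

lemma normalised_solution_in_constraint_set:
  "(\<lambda>x. theta \<alpha> \<Omega> \<omega> u * u x) \<in> constraint_set s p \<alpha> \<Omega> \<omega>"
proof -
  let ?\<theta> = "theta \<alpha> \<Omega> \<omega> u"
  have \<theta>: "0 \<le> ?\<theta>" by (simp add: theta_def)
  have "(\<integral>x. \<bar>?\<theta> * u x\<bar> powr (1 - \<alpha>) * \<omega> x \<partial>lebesgue_on \<Omega>)
      = (\<integral>x. ?\<theta> powr (1 - \<alpha>) * (\<omega> x * \<bar>u x\<bar> powr (1 - \<alpha>)) \<partial>lebesgue_on \<Omega>)"
    using \<theta> by (simp add: abs_mult powr_mult mult_ac)
  also have "\<dots> = ?\<theta> powr (1 - \<alpha>) * gagliardo_integral s p u"
    by (simp add: energy_identity(2))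
  \<comment> \<open>By the energy identity the normalising factor is itself a power of the energy of
    \<open>u\<close>.\<close>
  also have "\<dots> = gagliardo_integral s p u powr (- 1) * gagliardo_integral s p u"
    using \<alpha> by (simp add: theta_eq powr_powr)
  also have "\<dots> = 1"
    using gagliardo_integral_pos by (simp add: powr_minus)
  finally show ?thesis
    using Wsp0_cmult[OF u_Wsp0 _ \<theta>] p
    by (simp add: constraint_set_def set_lebesgue_integral_lebesgue_on[OF \<Omega>])
qed

lemma normalised_solution_energy:
  "gagliardo s p (\<lambda>x. theta \<alpha> \<Omega> \<omega> u * u x) powr p
    = gagliardo_integral s p u powr ((1 - \<alpha> - p) / (1 - \<alpha>))"
proof -
  let ?E = "gagliardo_integral s p u"
  have \<theta>: "0 \<le> theta \<alpha> \<Omega> \<omega> u" by (simp add: theta_def)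
  have "gagliardo s p (\<lambda>x. theta \<alpha> \<Omega> \<omega> u * u x) powr p = theta \<alpha> \<Omega> \<omega> u powr p * ?E"
    using gagliardo_finite_cmult[OF u_finite \<theta>] by (simp add: gagliardo_powr)
  also have "\<dots> = ?E powr (- p / (1 - \<alpha>)) * ?E powr 1"
    using gagliardo_integral_pos by (simp add: theta_eq powr_powr)
  also have "\<dots> = ?E powr (- p / (1 - \<alpha>) + 1)"
    by (simp only: powr_add)
  also have "- p / (1 - \<alpha>) + 1 = (1 - \<alpha> - p) / (1 - \<alpha>)"
    using \<alpha> by (simp add: field_simps)
  finally show ?thesis .
qed

end

section \<open>Integrability of the weight and conclusion\<close>

text \<open>The critical exponent exceeds 1, and division by \<open>1 - \<alpha>\<close> only
  enlarges it, so its Hoelder conjugate is at least 1; the other case is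
  \<open>1 / \<alpha>\<close>. The bound is what makes the weight integrable on a bounded
  domain.\<close>

lemma r_exponent_ge_1:
  assumes "0 < s" "1 < p" "0 < \<alpha>" "\<alpha> < 1" "0 < N"
  shows "1 \<le> r_exponent N s p \<alpha>"
proof (cases "s * p < N")
  case True
  define X where "X = N * p / (N - s * p)"
  define t where "t = X / (1 - \<alpha>)"
  have "N - s * p < N * p" using assms mult_strict_left_mono[of 1 p N] mult_pos_pos[of s p] by linarith
  then have X: "1 < X" using True by (simp add: X_def)
  then have "X * (1 - \<alpha>) \<le> X" using assms by (intro mult_left_le) auto
  then have "X \<le> t" using assms by (simp add: t_def pos_le_divide_eq)
  with X have "1 < t" by simp
  then show ?thesis
    using True by (simp add: r_exponent_def hoelder_conj_def critical_exponent_def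
        X_def[symmetric] t_def[symmetric])
qed (use assms in \<open>simp add: r_exponent_def\<close>)

lemma Lp_integrable:
  assumes "f \<in> Lp r M" "1 \<le> r" "finite_measure M"
  shows "integrable M f"
proof -
  interpret finite_measure M by fact
  have meas: "f \<in> borel_measurable M" using assms(1) by (simp add: Lp_def)
  show ?thesis
  proof (cases "r = \<infinity>")
    case True
    then obtain C where "AE x in M. norm (f x) \<le> C" using assms(1) by (auto simp: Lp_def)
    then show ?thesis using meas by (rule integrable_const_bound)
  next
    case False
    then obtain q where q: "r = ereal q" "1 \<le> q" using assms(2) by (cases r) auto
    show ?thesis
    proof (rule Bochner_Integration.integrable_bound)
      show "integrable M (\<lambda>x. 1 + \<bar>f x\<bar> powr q)" using assms(1) q by (simp add: Lp_def)
      \<comment> \<open>The constant 1 covers small values and is integrable because the measure is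
        finite.\<close>
      have "\<bar>f x\<bar> \<le> 1 + \<bar>f x\<bar> powr q" for x
      proof (cases "\<bar>f x\<bar> \<le> 1")
        case False
        then show ?thesis using powr_mono[of 1 q "\<bar>f x\<bar>"] q by simp
      qed (simp add: add_increasing2)
      then show "AE x in M. norm (f x) \<le> norm (1 + \<bar>f x\<bar> powr q)" by simp
    qed (rule meas)
  qed
qed

theorem theorem3p0p2:
  fixes \<Omega> :: "'a::euclidean_space set"
    and s p \<alpha> :: real and r :: ereal
    and \<omega> u U :: "'a \<Rightarrow> real"
  assumes "DIM('a) \<ge> 2"
    and "bounded_smooth_domain \<Omega>"
    and "0 < s" "s < 1" "1 < p"
    and "0 < \<alpha>" "\<alpha> < 1"
    and "ereal (r_exponent (real DIM('a)) s p \<alpha>) \<le> r"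
    and "\<omega> \<in> Lp r (lebesgue_on \<Omega>)"
    and "AE x in lebesgue_on \<Omega>. 0 \<le> \<omega> x"
    and "\<not> (AE x in lebesgue_on \<Omega>. \<omega> x = 0)"
    and "weak_solution s p \<alpha> \<Omega> \<omega> u"
  defines "U \<equiv> \<lambda>x. theta \<alpha> \<Omega> \<omega> u * u x"
  shows "gagliardo s p U powr p = gagliardo s p u powr (p * ((1 - \<alpha> - p) / (1 - \<alpha>))) \<and>
    is_arg_min (\<lambda>v. gagliardo s p v powr p) (\<lambda>v. v \<in> constraint_set s p \<alpha> \<Omega> \<omega>) U"
proof -
  have \<Omega>: "open \<Omega>" "bounded \<Omega>"
    using assms(2) by (auto simp: bounded_smooth_domain_def is_domain_def)
  then have "\<Omega> \<in> lmeasurable" by (intro lmeasurable_open)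
  then have fin: "finite_measure (lebesgue_on \<Omega>)"
    by (rule finite_measure_lebesgue_on)
  have "1 \<le> r_exponent (real DIM('a)) s p \<alpha>"
    using assms by (intro r_exponent_ge_1) auto
  then have "1 \<le> r"
    using assms(8) by (metis ereal_less_eq(3) one_ereal_def order_trans)
  then interpret singular_solution s p \<alpha> \<Omega> \<omega> u
    using assms \<Omega> Lp_integrable[OF assms(9) _ fin] by unfold_locales auto
  have "gagliardo s p u powr (p * ((1 - \<alpha> - p) / (1 - \<alpha>)))
      = gagliardo_integral s p u powr ((1 - \<alpha> - p) / (1 - \<alpha>))"
    by (simp only: powr_powr[symmetric] gagliardo_powr[OF u_finite])
  moreover have "gagliardo_integral s p u powr ((1 - \<alpha> - p) / (1 - \<alpha>)) \<le> gagliardo s p v powr p"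
    if v: "v \<in> constraint_set s p \<alpha> \<Omega> \<omega>" for v
  proof -
    \<comment> \<open>An infinite energy would be sent to 0 by \<open>enn2real\<close>, so
      finiteness is checked before the seminorm is identified with the integral.\<close>
    have "gagliardo_finite s p v"
      using v Wsp0_approximated[of v s p \<Omega>] assms(5)
      by (auto simp: constraint_set_def approximated_by_def)
    then show ?thesis using constraint_energy_ge[OF v] by (simp add: gagliardo_powr)
  qed
  ultimately show ?thesis
    using normalised_solution_in_constraint_set
    by (auto simp: U_def is_arg_min_def normalised_solution_energy not_less)
qed

end
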